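(* Let $R$ be a uniformly random $m\times n$ Latin rectangle, $d=n-m$, and let $C=M-\frac mn\mathbf 1\mathbf 1^{\mathsf T}$ be its centred used column–symbol matrix. (i) If $1\le m<n$, fix two distinct columns, labelled $1$ and $2$, and let $B_{12}=B_{12}(R)$ be the anchored blocker count for anchor column $1$ and second column $2$. Then $$\mathbb E\operatorname{tr}\bigl((C^{\mathsf T}C)^2\bigr)=\frac{n\,m(m-1)d+m^2d^2}{n-1}-n\,\mathbb E B_{12},$$ and consequently $$\mathbb E\operatorname{tr}\bigl((C^{\mathsf T}C)^2\bigr)\le\frac{n\,m(m-1)d+m^2d^2}{n-1}.$$ (ii) If $m=0$ or $m=n$, then $C=0$. (iii) There is an absolute constant $c<\infty$ such that $\mathbb E\operatorname{tr}\bigl((C^{\mathsf T}C)^2\bigr)\le c\,n m^2$ for all $n\ge1$ and all $0\le m\le n$.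
   Context: An $m\times n$ Latin rectangle is an $m\times n$ array with entries in $[n]=\{1,\dots,n\}$ such that every row is a permutation of $[n]$ and no symbol is repeated in a column. Its used column–symbol matrix is the $n\times n$ zero–one matrix $M$ with $M_{cs}=1$ iff symbol $s$ occurs in column $c$ of $R$. $\mathbf 1$ is the all-ones vector. For a column $c$, $S_c=S_c(R)$ is the set of symbols occurring in column $c$. For distinct columns $a,h$, the $(a,h)$-digraph of $R$ is the directed graph on vertex set $[n]$ with one directed edge $R_{r,a}\to R_{r,h}$ for every row $r$. Every vertex has indegree and outdegree at most one, so every nonisolated component is a directed cycle or a directed path (with at least one edge). A path component is a component that is a directed path with at least one edge; $\partial Q$ is the set of its two endpoint symbols. For distinct columns $a,b$ the anchored blocker count is $$B_{ab}(R)=\#\{(h,Q):\ h\ne a\text{ a column},\ Q\text{ a path component of the }(a,h)\text{-digraph of }R,\ \partial Q\subseteq S_b(R)\}.$$ *)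

theory Defs
  imports
    "HOL-Probability.Probability_Mass_Function"
    "Jordan_Normal_Form.Matrix"
    "Graph_Theory.Digraph_Component"
begin

text \<open>
  An array is a curried function \<open>R r c\<close> (row first, rows and columns numbered from 1).
  It is extensional outside the index ranges, so that each Latin rectangle is
  represented by exactly one function and uniform sampling is meaningful.
\<close>

definition latin_rectangles :: "nat \<Rightarrow> nat \<Rightarrow> (nat \<Rightarrow> nat \<Rightarrow> nat) set" where
  "latin_rectangles m n =
     {R \<in> {1..m} \<rightarrow>\<^sub>E ({1..n} \<rightarrow>\<^sub>E {1..n}).
        (\<forall>r\<in>{1..m}. bij_betw (R r) {1..n} {1..n}) \<and>
        (\<forall>c\<in>{1..n}. inj_on (\<lambda>r. R r c) {1..m})}"

lemma finite_latin_rectangles: "finite (latin_rectangles m n)"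
proof (rule finite_subset)
  show "latin_rectangles m n \<subseteq> {1..m} \<rightarrow>\<^sub>E ({1..n} \<rightarrow>\<^sub>E {1..n})"
    by (auto simp: latin_rectangles_def)
  show "finite ({1..m} \<rightarrow>\<^sub>E ({1..n} \<rightarrow>\<^sub>E {1..n::nat}))"
    by (intro finite_PiE) auto
qed

lemma inj_on_add_mod:
  fixes k n :: nat
  assumes "A \<subseteq> {1..n}"
  shows "inj_on (\<lambda>x. Suc ((k + x) mod n)) A"
proof -
  have le: "y \<le> x" if "x \<in> A" "y \<in> A" "(k + x) mod n = (k + y) mod n" for x y
  proof (rule ccontr)
    assume "\<not> y \<le> x"
    then have "x < y" by simp
    moreover have "n dvd (k + y) - (k + x)"
      using that(3) \<open>x < y\<close> by (subst mod_eq_dvd_iff_nat [symmetric]) auto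
    moreover have "1 \<le> x" "y \<le> n"
      using that assms by auto
    ultimately show False
      using dvd_imp_le[of n "y - x"] by simp
  qed
  show ?thesis
    by (rule inj_onI) (simp add: le order_antisym)
qed

lemma latin_rectangles_nonempty:
  assumes "m \<le> n"
  shows "latin_rectangles m n \<noteq> {}"
proof -
  define R where
    "R = (\<lambda>r\<in>{1..m}. \<lambda>c\<in>{1..n}. Suc ((r + c) mod n))"
  have R: "R r c = Suc ((r + c) mod n)" if "r \<in> {1..m}" "c \<in> {1..n}" for r c
    using that by (simp add: R_def)
  have range: "R r c \<in> {1..n}" if "r \<in> {1..m}" "c \<in> {1..n}" for r c
    using that by (simp add: R Suc_le_eq)
  have row: "bij_betw (R r) {1..n} {1..n}" if r: "r \<in> {1..m}" for r
  proof -
    have "inj_on (R r) {1..n} \<longleftrightarrow> inj_on (\<lambda>c. Suc ((r + c) mod n)) {1..n}"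
      by (rule inj_on_cong) (rule R[OF r])
    then have "inj_on (R r) {1..n}"
      using inj_on_add_mod[of "{1..n}" n r] by blast
    moreover have "R r ` {1..n} \<subseteq> {1..n}"
      using range[OF r] by blast
    ultimately show ?thesis
      unfolding bij_betw_def using endo_inj_surj[of "{1..n}" "R r"] by blast
  qed
  have col: "inj_on (\<lambda>r. R r c) {1..m}" if c: "c \<in> {1..n}" for c
  proof -
    have "inj_on (\<lambda>r. R r c) {1..m} \<longleftrightarrow> inj_on (\<lambda>r. Suc ((c + r) mod n)) {1..m}"
      by (rule inj_on_cong) (subst R[OF _ c], simp_all add: add.commute)
    moreover have "{1..m} \<subseteq> {1..n}"
      using assms by simp
    ultimately show ?thesis
      using inj_on_add_mod[of "{1..m}" n c] by blast
  qed
  have "R \<in> {1..m} \<rightarrow>\<^sub>E ({1..n} \<rightarrow>\<^sub>E {1..n})"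
    unfolding PiE_iff
  proof (intro conjI ballI)
    fix r assume r: "r \<in> {1..m}"
    show "R r c \<in> {1..n}" if "c \<in> {1..n}" for c
      using r that by (rule range)
    show "R r \<in> extensional {1..n}"
      using r by (simp add: R_def)
  next
    show "R \<in> extensional {1..m}"
      unfolding R_def by (rule restrict_extensional)
  qed
  then have "R \<in> latin_rectangles m n"
    unfolding latin_rectangles_def using row col by blast
  then show ?thesis by blast
qed

definition random_latin_rectangle :: "nat \<Rightarrow> nat \<Rightarrow> (nat \<Rightarrow> nat \<Rightarrow> nat) pmf" where
  "random_latin_rectangle m n = pmf_of_set (latin_rectangles m n)"

definition column_symbols :: "nat \<Rightarrow> (nat \<Rightarrow> nat \<Rightarrow> nat) \<Rightarrow> nat \<Rightarrow> nat set" where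
  "column_symbols m R c = (\<lambda>r. R r c) ` {1..m}"

text \<open>
  Matrix indices start at 0: entry \<open>(i, j)\<close> belongs to column \<open>i + 1\<close> and symbol \<open>j + 1\<close>.
\<close>

definition used_matrix :: "nat \<Rightarrow> nat \<Rightarrow> (nat \<Rightarrow> nat \<Rightarrow> nat) \<Rightarrow> real mat" where
  "used_matrix m n R =
     Matrix.mat n n (\<lambda>(i, j). if Suc j \<in> column_symbols m R (Suc i) then 1 else 0)"

definition ones_vec :: "nat \<Rightarrow> real Matrix.vec" where
  "ones_vec n = Matrix.vec n (\<lambda>_. 1)"

text \<open>
  The product of the single-column matrix and the single-row matrix of the all-ones
  vector \<open>u\<close> is the outer product of \<open>u\<close> with itself.
\<close>

definition centred_matrix :: "nat \<Rightarrow> nat \<Rightarrow> (nat \<Rightarrow> nat \<Rightarrow> nat) \<Rightarrow> real mat" where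
  "centred_matrix m n R =
     used_matrix m n R -
     (real m / real n) \<cdot>\<^sub>m (mat_of_cols n [ones_vec n] * mat_of_rows n [ones_vec n])"

definition mat_trace :: "'a::comm_monoid_add mat \<Rightarrow> 'a" where
  "mat_trace A = (\<Sum>i<dim_row A. A $$ (i, i))"

definition trace_stat :: "nat \<Rightarrow> nat \<Rightarrow> (nat \<Rightarrow> nat \<Rightarrow> nat) \<Rightarrow> real" where
  "trace_stat m n R =
     mat_trace ((transpose_mat (centred_matrix m n R) * centred_matrix m n R) ^\<^sub>m 2)"

text \<open>The arcs of the \<open>(a, h)\<close>-digraph are the row indices themselves.\<close>

definition column_digraph ::
    "nat \<Rightarrow> nat \<Rightarrow> (nat \<Rightarrow> nat \<Rightarrow> nat) \<Rightarrow> nat \<Rightarrow> nat \<Rightarrow> (nat, nat) pre_digraph" where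
  "column_digraph m n R a h =
     \<lparr>verts = {1..n}, arcs = {1..m}, tail = (\<lambda>r. R r a), head = (\<lambda>r. R r h)\<rparr>"

text \<open>
  \<open>Q\<close> consists of exactly the vertices and arcs of a directed path \<open>p\<close> from \<open>u\<close> to \<open>v\<close>
  that has at least one arc.
\<close>

definition is_dipath :: "('a, 'b) pre_digraph \<Rightarrow> 'a \<Rightarrow> 'b list \<Rightarrow> 'a \<Rightarrow> bool" where
  "is_dipath Q u p v \<longleftrightarrow>
     pre_digraph.apath Q u p v \<and> p \<noteq> [] \<and>
     verts Q = set (pre_digraph.awalk_verts Q u p) \<and> arcs Q = set p"

text \<open>
  Components are weak ones: \<^const>\<open>Digraph_Component.connected\<close> ignores the direction of arcs.
\<close>

definition path_component :: "('a, 'b) pre_digraph \<Rightarrow> ('a, 'b) pre_digraph \<Rightarrow> bool" where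
  "path_component G Q \<longleftrightarrow>
     pre_digraph.max_subgraph G Digraph_Component.connected Q \<and> (\<exists>u p v. is_dipath Q u p v)"

definition path_ends :: "('a, 'b) pre_digraph \<Rightarrow> 'a set" where
  "path_ends Q = {x. \<exists>u p v. is_dipath Q u p v \<and> x \<in> {u, v}}"

definition blocker_count ::
    "nat \<Rightarrow> nat \<Rightarrow> nat \<Rightarrow> nat \<Rightarrow> (nat \<Rightarrow> nat \<Rightarrow> nat) \<Rightarrow> nat" where
  "blocker_count m n a b R =
     card {(h, Q). h \<in> {1..n} \<and> h \<noteq> a \<and> path_component (column_digraph m n R a h) Q \<and>
                   path_ends Q \<subseteq> column_symbols m R b}"

end

theory Submission
  imports Defs
begin

text \<open>
  Write \<open>S\<^sub>c\<close> for the set of symbols in column \<open>c\<close>, \<open>X = |S\<^sub>a \<inter> S\<^sub>b|\<close> for the overlap of two distinct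
  columns and \<open>d = n - m\<close>. The trace of \<open>(C\<^sup>T C)\<^sup>2\<close> equals that of \<open>(C C\<^sup>T)\<^sup>2\<close>, which is the sum of
  \<open>(|S\<^sub>i \<inter> S\<^sub>j| - m\<^sup>2 / n)\<^sup>2\<close> over all pairs of columns (\<open>trace_stat_eq_overlaps\<close>). The diagonal terms
  are constant and the columns of a uniform Latin rectangle are exchangeable
  (\<open>average_overlap_exchangeable\<close>), so only the means of \<open>X\<close> and \<open>X\<^sup>2\<close> for one pair are needed.

  They come from a switch that preserves the uniform distribution. Take a column \<open>h\<close> other than
  \<open>a\<close> and \<open>b\<close> and a path component of the \<open>(a, h)\<close>-digraph, running from \<open>u\<close> to \<open>v\<close>. Exchanging the
  entries of columns \<open>a\<close> and \<open>h\<close> in the rows of the path gives another Latin rectangle, in which the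
  reversed path is again a path component. Hence switching is an involution on pairs of a rectangle
  and a path, and for every function \<open>f\<close> the increments of \<open>f X\<close> add up to zero over all such pairs
  (\<open>sum_overlap_increments\<close>). The switch replaces \<open>u\<close> by \<open>v\<close> in \<open>S\<^sub>a\<close>, so it changes \<open>X\<close> by
  \<open>[v \<in> S\<^sub>b] - [u \<in> S\<^sub>b]\<close>. For a fixed rectangle and summed over all \<open>h\<close> and all paths, the event
  \<open>u \<in> S\<^sub>b\<close> occurs \<open>d X\<close> times, the event \<open>v \<in> S\<^sub>b\<close> occurs \<open>(m - 1) (m - X)\<close> times, and both occur
  together \<open>B\<^sub>a\<^sub>b\<close> times. For \<open>f X = X\<close> this determines the mean of \<open>X\<close>; for \<open>f X = X\<^sup>2\<close> it expresses
  the mean of \<open>X\<^sup>2\<close> by that of \<open>B\<^sub>a\<^sub>b\<close> (\<open>average_overlap_moments\<close>). The inequalities follow from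
  \<open>B\<^sub>a\<^sub>b \<ge> 0\<close>.

  All degrees of the \<open>(a, h)\<close>-digraph are at most one, so its path components correspond to the
  lists of rows that form a directed path which cannot be prolonged
  (\<open>bij_betw_chain_path_components\<close>). The switching argument works with these lists: such a list is
  determined by the start of its path as well as by the end, and reversing the path reverses the
  list.
\<close>

section \<open>Maximal chains of a partial injection\<close>

text \<open>
  For \<open>t\<close> and \<open>h\<close> injective on \<open>E\<close>, the arcs \<open>t e \<rightarrow> h e\<close> form a digraph with all degrees at
  most one. A directed path that cannot be prolonged at either end is recorded by its list of
  arcs; distinctness is not imposed because it follows from the start having no incoming arc.
\<close>

definition maximal_chain :: "('e \<Rightarrow> 'v) \<Rightarrow> ('e \<Rightarrow> 'v) \<Rightarrow> 'e set \<Rightarrow> 'e list \<Rightarrow> bool" where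
  "maximal_chain t h E p \<longleftrightarrow>
     p \<noteq> [] \<and> set p \<subseteq> E \<and> successively (\<lambda>e f. h e = t f) p \<and>
     t (hd p) \<notin> h ` E \<and> h (last p) \<notin> t ` E"

text \<open>
  If an arc repeated, following the chain backwards from both occurrences would, by injectivity
  of \<open>h\<close>, bring the first arc to a later position and so give the start an incoming arc.
\<close>

lemma chain_distinct:
  assumes "inj_on h E" "set p \<subseteq> E" "successively (\<lambda>e f. h e = t f) p" "t (hd p) \<notin> h ` E"
  shows "distinct p"
proof -
  have step: "h (p ! i) = t (p ! Suc i)" if "Suc i < length p" for i
    using assms(3) that by (auto simp: successively_conv_nth)
  have inE: "p ! i \<in> E" if "i < length p" for i
    using assms(2) that by auto
  have "p ! i \<noteq> p ! j" if "i < j" "j < length p" for i j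
    using that
  proof (induction i arbitrary: j)
    case 0
    then obtain j' where j: "j = Suc j'" by (cases j) auto
    have "t (p ! j) \<in> h ` E"
      using step[of j'] inE[of j'] 0 j by (metis Suc_lessD image_eqI)
    moreover have "p ! 0 = hd p" using 0 by (cases p) auto
    ultimately show ?case using assms(4) by metis
  next
    case (Suc i)
    then obtain j' where j: "j = Suc j'" by (cases j) auto
    have "p ! i \<noteq> p ! j'" using Suc j by auto
    then have "h (p ! i) \<noteq> h (p ! j')"
      using inj_onD[OF assms(1)] inE Suc.prems j by (meson Suc_lessD less_trans)
    then show ?case using step[of i] step[of j'] Suc.prems j by auto
  qed
  then show ?thesis by (metis distinct_conv_nth linorder_neq_iff)
qed

lemma maximal_chain_rev:
  assumes "maximal_chain t h E p"
  shows "maximal_chain h t E (rev p)"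
  using assms unfolding maximal_chain_def successively_rev
  by (simp add: hd_rev last_rev eq_commute)

text \<open>
  Injectivity of \<open>t\<close> leaves no choice when the chain is prolonged, and maximality fixes where
  it stops.
\<close>

lemma maximal_chain_unique:
  assumes "inj_on t E" "maximal_chain t h E p" "maximal_chain t h E q" "t (hd p) = t (hd q)"
  shows "p = q"
proof -
  have "p = q" if "p \<noteq> []" "q \<noteq> []" "set p \<subseteq> E" "set q \<subseteq> E" "t (hd p) = t (hd q)"
    "successively (\<lambda>e f. h e = t f) p" "successively (\<lambda>e f. h e = t f) q"
    "h (last p) \<notin> t ` E" "h (last q) \<notin> t ` E"
    using that
  proof (induction p arbitrary: q)
    case Nil
    then show ?case by simp
  next
    case (Cons e p)
    then obtain f q' where q: "q = f # q'" by (cases q) auto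
    have ef: "e = f" using Cons.prems q inj_onD[OF assms(1)] by auto
    show ?case
    proof (cases "p = [] \<or> q' = []")
      case True
      then show ?thesis
        using Cons.prems ef q by (cases p; cases q') auto
    next
      case False
      then have "h e = t (hd p)" "h f = t (hd q')"
        using Cons.prems q by (auto simp: successively_Cons)
      then have "p = q'"
        using Cons.prems False ef q by (intro Cons.IH) (auto simp: successively_Cons)
      then show ?thesis using ef q by simp
    qed
  qed
  then show ?thesis using assms(2-4) by (simp add: maximal_chain_def)
qed

text \<open>
  Chains starting at \<open>u\<close> have distinct arcs, so their length is at most \<open>card E\<close>; a longest
  one cannot be prolonged.
\<close>

lemma maximal_chain_exists:
  assumes "finite E" "inj_on h E" "u \<in> t ` E - h ` E"
  shows "\<exists>p. maximal_chain t h E p \<and> t (hd p) = u"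
proof -
  define P where "P p \<longleftrightarrow> p \<noteq> [] \<and> set p \<subseteq> E \<and> successively (\<lambda>e f. h e = t f) p \<and> t (hd p) = u" for p
  have bound: "length p \<le> card E" if "P p" for p
  proof -
    have "distinct p" using that assms by (intro chain_distinct[of h E p t]) (auto simp: P_def)
    then have "length p = card (set p)" by (simp add: distinct_card)
    also have "\<dots> \<le> card E" using that assms(1) by (intro card_mono) (auto simp: P_def)
    finally show ?thesis .
  qed
  obtain e where "e \<in> E" "t e = u" using assms(3) by auto
  then have "P [e]" by (auto simp: P_def)
  then obtain p where p: "P p" and longest: "\<And>q. P q \<Longrightarrow> length q \<le> length p"
    using Lattices_Big.ex_has_greatest_nat[of P "[e]" length "Suc (card E)"] bound
    by (metis less_Suc_eq_le)
  have "h (last p) \<notin> t ` E"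
  proof
    assume "h (last p) \<in> t ` E"
    then obtain f where "f \<in> E" "h (last p) = t f" by auto
    then have "P (p @ [f])" using p by (auto simp: P_def successively_append_iff)
    then show False using longest[of "p @ [f]"] by simp
  qed
  then have "maximal_chain t h E p \<and> t (hd p) = u"
    using p assms(3) by (simp add: P_def maximal_chain_def)
  then show ?thesis by blast
qed

lemma bij_betw_chain_start:
  assumes "finite E" "inj_on t E" "inj_on h E"
  shows "bij_betw (\<lambda>p. t (hd p)) {p. maximal_chain t h E p} (t ` E - h ` E)"
  unfolding bij_betw_def
proof
  show "inj_on (\<lambda>p. t (hd p)) {p. maximal_chain t h E p}"
    using maximal_chain_unique[OF assms(2), of h] by (auto simp: inj_on_def)
  show "(\<lambda>p. t (hd p)) ` {p. maximal_chain t h E p} = t ` E - h ` E"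
  proof (intro equalityI subsetI)
    fix u assume "u \<in> t ` E - h ` E"
    then obtain p where "maximal_chain t h E p" "t (hd p) = u"
      using maximal_chain_exists[OF assms(1,3)] by metis
    then show "u \<in> (\<lambda>p. t (hd p)) ` {p. maximal_chain t h E p}"
      by (intro image_eqI[of _ _ p]) simp_all
  qed (auto simp: maximal_chain_def dest: hd_in_set)
qed

lemma bij_betw_chain_end:
  assumes "finite E" "inj_on t E" "inj_on h E"
  shows "bij_betw (\<lambda>p. h (last p)) {p. maximal_chain t h E p} (h ` E - t ` E)"
proof -
  have "bij_betw rev {p. maximal_chain t h E p} {p. maximal_chain h t E p}"
    by (rule bij_betw_byWitness[where f' = rev]) (auto dest: maximal_chain_rev)
  from bij_betw_trans[OF this bij_betw_chain_start[OF assms(1,3,2)]]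
  have "bij_betw (\<lambda>p. h (hd (rev p))) {p. maximal_chain t h E p} (h ` E - t ` E)"
    by (simp add: comp_def)
  then show ?thesis
    by (rule iffD1[OF bij_betw_cong, rotated]) (auto simp: hd_rev maximal_chain_def)
qed

text \<open>
  This makes switching an involution: reversing exactly the arcs of a maximal chain turns it into
  the reversed chain, which is again maximal.
\<close>

lemma maximal_chain_reverse_arcs:
  assumes "maximal_chain t h E p"
    and "\<And>e. e \<in> set p \<Longrightarrow> t' e = h e \<and> h' e = t e"
    and "\<And>e. e \<in> E - set p \<Longrightarrow> t' e = t e \<and> h' e = h e"
    and "inj_on t E" "inj_on h E"
  shows "maximal_chain t' h' E (rev p)"
proof -
  have p: "p \<noteq> []" "set p \<subseteq> E" "successively (\<lambda>e f. h e = t f) p"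
    "t (hd p) \<notin> h ` E" "h (last p) \<notin> t ` E"
    using assms(1) by (auto simp: maximal_chain_def)
  have "successively (\<lambda>f e. h' f = t' e) (rev p)"
    unfolding successively_rev
    using p(3) by (rule successively_mono) (use assms(2) in auto)
  moreover have "h (last p) \<notin> h' ` E"
  proof
    assume "h (last p) \<in> h' ` E"
    then obtain e where e: "e \<in> E" "h (last p) = h' e" by auto
    show False
    proof (cases "e \<in> set p")
      case True
      then show False using e assms(2) p(5) by auto
    next
      case False
      then have "h (last p) = h e" using e assms(3) by auto
      then have "last p = e" using inj_onD[OF assms(5)] e p last_in_set by (metis subsetD)
      then show False using False p(1) by auto
    qed
  qed
  moreover have "t (hd p) \<notin> t' ` E"
  proof
    assume "t (hd p) \<in> t' ` E"
    then obtain e where e: "e \<in> E" "t (hd p) = t' e" by auto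
    show False
    proof (cases "e \<in> set p")
      case True
      then show False using e assms(2) p(2,4) by auto
    next
      case False
      then have "t (hd p) = t e" using e assms(3) by auto
      then have "hd p = e" using inj_onD[OF assms(4)] e p hd_in_set by (metis subsetD)
      then show False using False p(1) by auto
    qed
  qed
  ultimately show ?thesis
    using p(1,2) assms(2) by (auto simp: maximal_chain_def hd_rev last_rev)
qed

text \<open>
  Both sides list the vertices of the path. Taken as sets, they show that the heads and the tails
  of the arcs differ only by the two ends.
\<close>

lemma chain_tails_heads:
  assumes "p \<noteq> []" "successively (\<lambda>e f. h e = t f) p"
  shows "t (hd p) # map h p = map t p @ [h (last p)]"
  using assms
  by (induction p rule: induct_list012) auto

section \<open>Path components as maximal chains\<close>

definition chain_graph :: "('v, 'e) pre_digraph \<Rightarrow> 'e list \<Rightarrow> ('v, 'e) pre_digraph" where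
  "chain_graph G p =
     \<lparr>verts = insert (tail G (hd p)) (head G ` set p), arcs = set p, tail = tail G, head = head G\<rparr>"

lemma chain_graph_verts_tails:
  assumes "p \<noteq> []" "successively (\<lambda>e f. head G e = tail G f) p"
  shows "verts (chain_graph G p) = insert (head G (last p)) (tail G ` set p)"
  using arg_cong[OF chain_tails_heads[OF assms], of set] by (simp add: chain_graph_def)

lemma cas_iff_successively:
  "p \<noteq> [] \<Longrightarrow> pre_digraph.cas G u p v \<longleftrightarrow>
     tail G (hd p) = u \<and> head G (last p) = v \<and> successively (\<lambda>e f. head G e = tail G f) p"
  by (induction p arbitrary: u rule: induct_list012) (auto simp: pre_digraph.cas.simps)

lemma awalk_verts_chain:
  assumes "p \<noteq> []" "successively (\<lambda>e f. head G e = tail G f) p"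
  shows "pre_digraph.awalk_verts G (tail G (hd p)) p = tail G (hd p) # map (head G) p"
  using assms chain_tails_heads[OF assms] by (simp add: pre_digraph.awalk_verts_conv)

lemma is_dipath_iff:
  "is_dipath Q u p v \<longleftrightarrow>
     p \<noteq> [] \<and> successively (\<lambda>e f. head Q e = tail Q f) p \<and> u = tail Q (hd p) \<and> v = head Q (last p) \<and>
     distinct (u # map (head Q) p) \<and> verts Q = insert u (head Q ` set p) \<and> arcs Q = set p"
  unfolding is_dipath_def pre_digraph.apath_def pre_digraph.awalk_def
  using cas_iff_successively[of p Q u v] awalk_verts_chain[of p Q] by auto

lemma connected_iff_rtrancl:
  assumes "wf_digraph H"
  shows "Digraph_Component.connected H \<longleftrightarrow>
    verts H \<noteq> {} \<and> (\<forall>u\<in>verts H. \<forall>v\<in>verts H. (u, v) \<in> (parcs (mk_symmetric H))\<^sup>*)"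
proof -
  interpret pair_wf_digraph "mk_symmetric H"
    using assms by (rule wf_digraph.wellformed_mk_symmetric)
  show ?thesis
    unfolding Digraph_Component.connected_def strongly_connected_def reachable_conv
    by auto
qed

text \<open>
  Otherwise adding the arc and its ends would give a larger connected subgraph.
\<close>

lemma max_connected_subgraph_arc:
  assumes wf: "wf_digraph G" and max: "pre_digraph.max_subgraph G Digraph_Component.connected Q"
    and e: "e \<in> arcs G" "tail G e \<in> verts Q \<or> head G e \<in> verts Q"
  shows "e \<in> arcs Q"
proof -
  let ?H = "\<lparr>verts = verts Q \<union> {tail G e, head G e}, arcs = insert e (arcs Q), tail = tail G, head = head G\<rparr>"
  have sub: "subgraph Q G" and con: "Digraph_Component.connected Q"
    and no: "\<And>H. H \<noteq> Q \<Longrightarrow> subgraph Q H \<Longrightarrow> subgraph H G \<Longrightarrow> \<not> Digraph_Component.connected H"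
    using max by (auto simp: pre_digraph.max_subgraph_def)
  interpret G: wf_digraph G by fact
  have Q: "verts Q \<subseteq> verts G" "arcs Q \<subseteq> arcs G" "tail Q = tail G" "head Q = head G" "wf_digraph Q"
    using sub by (auto simp: subgraph_def compatible_def)
  interpret Q: wf_digraph Q by fact
  have wfH: "wf_digraph ?H"
    using Q.wellformed Q by unfold_locales auto
  have "subgraph Q ?H"
    using Q wfH by (auto simp: subgraph_def compatible_def)
  moreover have "subgraph ?H G"
    using Q wfH wf e(1) by (auto simp: subgraph_def compatible_def)
  moreover have "Digraph_Component.connected ?H"
  proof -
    let ?L = "parcs (mk_symmetric ?H)"
    have sym: "sym (?L\<^sup>*)"
      by (intro sym_rtrancl symI) (auto simp: parcs_mk_symmetric)
    have "parcs (mk_symmetric Q) \<subseteq> ?L"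
      using Q by (auto simp: parcs_mk_symmetric)
    then have old: "(x, y) \<in> ?L\<^sup>*" if "x \<in> verts Q" "y \<in> verts Q" for x y
      using con that rtrancl_mono[of "parcs (mk_symmetric Q)" ?L]
      unfolding connected_iff_rtrancl[OF Q(5)] by blast
    have E: "(tail G e, head G e) \<in> ?L\<^sup>*" "(head G e, tail G e) \<in> ?L\<^sup>*"
      by (auto simp: parcs_mk_symmetric intro!: r_into_rtrancl)
    obtain x where x: "x \<in> verts Q" "(x, tail G e) \<in> ?L\<^sup>*" "(x, head G e) \<in> ?L\<^sup>*"
      using e(2) E by blast
    have "(x, y) \<in> ?L\<^sup>*" if "y \<in> verts ?H" for y
      using that old x by auto
    then have "(y, z) \<in> ?L\<^sup>*" if "y \<in> verts ?H" "z \<in> verts ?H" for y z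
      using that sym by (meson rtrancl_trans symD)
    moreover have "verts ?H \<noteq> {}" by simp
    ultimately show ?thesis
      unfolding connected_iff_rtrancl[OF wfH] by blast
  qed
  ultimately have "?H = Q" using no by blast
  then show ?thesis by (metis insertI1 pre_digraph.select_convs(2))
qed

text \<open>
  An arc entering \<open>u\<close> or leaving \<open>v\<close> would belong to the component, hence to the path; but
  the vertices of the path are distinct, so its first vertex is no head and its last vertex is no
  tail of an arc of the path.
\<close>

lemma path_component_imp_chain:
  assumes "wf_digraph G" "pre_digraph.max_subgraph G Digraph_Component.connected Q" "is_dipath Q u p v"
  shows "maximal_chain (tail G) (head G) (arcs G) p" "Q = chain_graph G p"
proof -
  have Q: "verts Q \<subseteq> verts G" "arcs Q \<subseteq> arcs G" "tail Q = tail G" "head Q = head G"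
    using assms(2) by (auto simp: pre_digraph.max_subgraph_def subgraph_def compatible_def)
  have p: "p \<noteq> []" "successively (\<lambda>e f. head G e = tail G f) p" "u = tail G (hd p)" "v = head G (last p)"
     "distinct (u # map (head G) p)" "verts Q = insert u (head G ` set p)" "arcs Q = set p"
    using assms(3) Q by (auto simp: is_dipath_iff)
  show "Q = chain_graph G p" using p Q by (simp add: chain_graph_def)
  note th = chain_tails_heads[OF p(1,2)]
  have "u \<notin> head G ` arcs G"
  proof
    assume "u \<in> head G ` arcs G"
    then obtain e where "e \<in> arcs G" "u = head G e" by auto
    then have "e \<in> arcs Q" using p by (intro max_connected_subgraph_arc[OF assms(1,2)]) auto
    then show False using \<open>u = head G e\<close> p by auto
  qed
  moreover have "v \<notin> tail G ` arcs G"
  proof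
    assume "v \<in> tail G ` arcs G"
    then obtain e where "e \<in> arcs G" "v = tail G e" by auto
    moreover have "v \<in> verts Q" using p(1,4,6) by auto
    ultimately have "e \<in> arcs Q" by (intro max_connected_subgraph_arc[OF assms(1,2)]) auto
    moreover have "distinct (map (tail G) p @ [v])" using p(5) th p(3,4) by simp
    ultimately show False using \<open>v = tail G e\<close> p(7) by auto
  qed
  ultimately show "maximal_chain (tail G) (head G) (arcs G) p"
    using p Q by (auto simp: maximal_chain_def)
qed

text \<open>
  Every arc of \<open>G\<close> that touches the path belongs to it: inner vertices have used up their one
  incoming and one outgoing arc, and the ends have no other arc by maximality. A connected subgraph
  containing the path can therefore not leave it.
\<close>

lemma chain_imp_path_component:
  assumes wf: "wf_digraph G" and inj: "inj_on (tail G) (arcs G)" "inj_on (head G) (arcs G)"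
    and chain: "maximal_chain (tail G) (head G) (arcs G) p"
  shows "is_dipath (chain_graph G p) (tail G (hd p)) p (head G (last p))"
    and "path_component G (chain_graph G p)"
proof -
  let ?Q = "chain_graph G p"
  interpret G: wf_digraph G by fact
  have p: "p \<noteq> []" "set p \<subseteq> arcs G" "successively (\<lambda>e f. head G e = tail G f) p"
    "tail G (hd p) \<notin> head G ` arcs G" "head G (last p) \<notin> tail G ` arcs G"
    using chain by (auto simp: maximal_chain_def)
  have Qs: "arcs ?Q = set p" "tail ?Q = tail G" "head ?Q = head G"
    "verts ?Q = insert (tail G (hd p)) (head G ` set p)"
    by (simp_all add: chain_graph_def)
  have V: "verts ?Q = insert (head G (last p)) (tail G ` set p)"
    by (rule chain_graph_verts_tails[OF p(1,3)])
  have "distinct p" by (rule chain_distinct[OF inj(2) p(2,3,4)])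
  then have dist: "distinct (tail G (hd p) # map (head G) p)"
    using p(2,4) inj_on_subset[OF inj(2) p(2)] by (auto simp: distinct_map)
  show dip: "is_dipath ?Q (tail G (hd p)) p (head G (last p))"
    using p dist by (simp add: is_dipath_iff Qs)
  have closed: "e \<in> set p" if "e \<in> arcs G" "tail G e \<in> verts ?Q \<or> head G e \<in> verts ?Q" for e
    using that(2)
  proof
    assume "tail G e \<in> verts ?Q"
    then obtain f where "f \<in> set p" "tail G e = tail G f"
      using imageI[OF \<open>e \<in> arcs G\<close>, of "tail G"] p(5) V by auto
    then show ?thesis using that(1) p(2) inj_onD[OF inj(1)] by (metis subsetD)
  next
    assume "head G e \<in> verts ?Q"
    then obtain f where "f \<in> set p" "head G e = head G f"
      using imageI[OF \<open>e \<in> arcs G\<close>, of "head G"] p(4) Qs by auto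
    then show ?thesis using that(1) p(2) inj_onD[OF inj(2)] by (metis subsetD)
  qed
  have wfQ: "wf_digraph ?Q" 
    by unfold_locales (use V Qs in auto)
  have start: "tail G (hd p) \<in> verts G"
    using hd_in_set[OF p(1)] p(2) by (intro G.tail_in_verts) blast
  have sub: "subgraph ?Q G"
    using p wf wfQ Qs start by (auto simp: subgraph_def compatible_def)
  have con: "Digraph_Component.connected ?Q"
  proof -
    let ?L = "parcs (mk_symmetric ?Q)" and ?u = "tail G (hd p)"
    have sym: "sym (?L\<^sup>*)"
      by (intro sym_rtrancl symI) (auto simp: parcs_mk_symmetric)
    have arc: "(tail G e, head G e) \<in> ?L" if "e \<in> set p" for e
      using that by (auto simp: parcs_mk_symmetric Qs)
    have "(?u, head G (p ! i)) \<in> ?L\<^sup>*" if "i < length p" for i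
      using that
    proof (induction i)
      case 0
      then show ?case using arc[of "hd p"] p(1) by (auto simp: hd_conv_nth)
    next
      case (Suc i)
      then have "head G (p ! i) = tail G (p ! Suc i)"
        using p(3) by (auto simp: successively_conv_nth)
      then show ?case using Suc arc[of "p ! Suc i"] by (auto intro: rtrancl_into_rtrancl)
    qed
    then have "(?u, x) \<in> ?L\<^sup>*" if "x \<in> verts ?Q" for x
      using that unfolding Qs(4) by (auto simp: in_set_conv_nth)
    then have "(x, y) \<in> ?L\<^sup>*" if "x \<in> verts ?Q" "y \<in> verts ?Q" for x y
      using that sym by (meson rtrancl_trans symD)
    then show ?thesis
      unfolding connected_iff_rtrancl[OF wfQ] by (auto simp: Qs(4))
  qed
  have "H = ?Q" if H: "subgraph ?Q H" "subgraph H G" "Digraph_Component.connected H" for H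
  proof -
    have HG: "arcs H \<subseteq> arcs G" "tail H = tail G" "head H = head G" "wf_digraph H"
      using H(2) by (auto simp: subgraph_def compatible_def)
    interpret H: wf_digraph H by fact
    have QH: "verts ?Q \<subseteq> verts H" "arcs ?Q \<subseteq> arcs H"
      using H(1) by (auto simp: subgraph_def)
    have "verts H \<subseteq> verts ?Q"
    proof
      fix y assume "y \<in> verts H"
      then have "(tail G (hd p), y) \<in> (parcs (mk_symmetric H))\<^sup>*"
        using H(3) QH(1) by (auto simp: connected_iff_rtrancl[OF HG(4)] Qs)
      then show "y \<in> verts ?Q"
      proof (induction rule: rtrancl_induct)
        case base
        then show ?case by (simp add: Qs)
      next
        case (step y z)
        then obtain e where e: "e \<in> arcs H" "{y, z} = {tail G e, head G e}"
          using HG by (auto simp: parcs_mk_symmetric)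
        then have "e \<in> set p" using closed[of e] step HG by (auto simp: doubleton_eq_iff)
        then show ?case using e V Qs(4) by (auto simp: doubleton_eq_iff)
      qed
    qed
    moreover have "arcs H \<subseteq> arcs ?Q"
    proof
      fix e assume "e \<in> arcs H"
      then show "e \<in> arcs ?Q"
        using closed[of e] H.wellformed(1)[of e] HG calculation Qs(1) by auto
    qed
    ultimately show ?thesis
      using QH HG Qs by (intro pre_digraph.equality) auto
  qed
  then show "path_component G ?Q"
    unfolding path_component_def pre_digraph.max_subgraph_def using sub con dip by blast
qed

text \<open>
  A path component may be presented by several dipaths only if these share their ends: the start is
  the only vertex without an incoming arc, the end the only one without an outgoing arc.
\<close>

lemma path_ends_chain_graph:
  assumes "wf_digraph G" "inj_on (tail G) (arcs G)" "inj_on (head G) (arcs G)"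
    and "maximal_chain (tail G) (head G) (arcs G) p"
  shows "path_ends (chain_graph G p) = {tail G (hd p), head G (last p)}"
proof -
  let ?Q = "chain_graph G p"
  have dip: "is_dipath ?Q (tail G (hd p)) p (head G (last p))"
    by (rule chain_imp_path_component(1)[OF assms])
  have ends: "u = tail G (hd p) \<and> v = head G (last p)" if "is_dipath ?Q u q v" for u q v
  proof -
    have q: "q \<noteq> []" "successively (\<lambda>e f. head G e = tail G f) q" "u = tail G (hd q)" "v = head G (last q)"
      "distinct (u # map (head G) q)" "set p = set q"
      using that by (auto simp: is_dipath_iff chain_graph_def)
    have p: "p \<noteq> []" "successively (\<lambda>e f. head G e = tail G f) p"
      using assms(4) by (auto simp: maximal_chain_def)
    have verts: "verts ?Q = insert u (head G ` set q)"
      using that unfolding is_dipath_iff by (elim conjE)  (simp add: chain_graph_def)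
    have "distinct (map (tail G) q @ [v])"
      using q(5) chain_tails_heads[OF q(1,2)] q(3,4) by simp
    then have "v \<notin> tail G ` set p" using q(6) by auto
    moreover have "v \<in> verts ?Q" using verts q by auto
    ultimately have "v = head G (last p)"
      using chain_graph_verts_tails[OF p] by auto
    moreover have "u \<notin> head G ` set p" using q by auto
    then have "u = tail G (hd p)"
      using verts by (auto simp: chain_graph_def)
    ultimately show ?thesis by simp
  qed
  show ?thesis
    unfolding path_ends_def using dip ends by blast
qed

lemma bij_betw_chain_path_components:
  assumes "wf_digraph G" "inj_on (tail G) (arcs G)" "inj_on (head G) (arcs G)"
  shows "bij_betw (chain_graph G)
    {p. maximal_chain (tail G) (head G) (arcs G) p \<and> {tail G (hd p), head G (last p)} \<subseteq> S}
    {Q. path_component G Q \<and> path_ends Q \<subseteq> S}"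
  unfolding bij_betw_def
proof
  let ?C = "maximal_chain (tail G) (head G) (arcs G)"
  show "inj_on (chain_graph G) {p. ?C p \<and> {tail G (hd p), head G (last p)} \<subseteq> S}"
  proof (rule inj_onI)
    fix p q assume "p \<in> {p. ?C p \<and> {tail G (hd p), head G (last p)} \<subseteq> S}"
      "q \<in> {p. ?C p \<and> {tail G (hd p), head G (last p)} \<subseteq> S}" and eq: "chain_graph G p = chain_graph G q"
    then have C: "?C p" "?C q" by auto
    have "tail G (hd p) \<in> verts (chain_graph G q)"
      unfolding eq[symmetric] by (simp add: chain_graph_def)
    moreover have "tail G (hd p) \<notin> head G ` set q"
      using C by (auto simp: maximal_chain_def)
    ultimately have "tail G (hd p) = tail G (hd q)"
      by (simp add: chain_graph_def)
    then show "p = q" by (rule maximal_chain_unique[OF assms(2) C])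
  qed
  show "chain_graph G ` {p. ?C p \<and> {tail G (hd p), head G (last p)} \<subseteq> S}
      = {Q. path_component G Q \<and> path_ends Q \<subseteq> S}"
  proof (intro equalityI subsetI)
    fix Q assume Q: "Q \<in> {Q. path_component G Q \<and> path_ends Q \<subseteq> S}"
    then obtain u p v where "pre_digraph.max_subgraph G Digraph_Component.connected Q" "is_dipath Q u p v"
      by (auto simp: path_component_def)
    note p = path_component_imp_chain[OF assms(1) this]
    show "Q \<in> chain_graph G ` {p. ?C p \<and> {tail G (hd p), head G (last p)} \<subseteq> S}"
      using Q p path_ends_chain_graph[OF assms p(1)] by auto
  qed (auto simp: path_ends_chain_graph[OF assms] chain_imp_path_component(2)[OF assms])
qed

section \<open>Columns of a Latin rectangle\<close>

lemma latin_rectanglesD: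
  assumes "R \<in> latin_rectangles m n"
  shows "r \<in> {1..m} \<Longrightarrow> bij_betw (R r) {1..n} {1..n}"
    and "c \<in> {1..n} \<Longrightarrow> inj_on (\<lambda>r. R r c) {1..m}"
  using assms by (auto simp: latin_rectangles_def)

lemma column_symbols_subset:
  assumes "R \<in> latin_rectangles m n" "c \<in> {1..n}"
  shows "column_symbols m R c \<subseteq> {1..n}"
  using latin_rectanglesD(1)[OF assms(1)] assms(2) unfolding column_symbols_def
  by (meson bij_betwE image_subsetI)

lemma card_column_symbols:
  assumes "R \<in> latin_rectangles m n" "c \<in> {1..n}"
  shows "card (column_symbols m R c) = m"
  using card_image[OF latin_rectanglesD(2)[OF assms]] by (simp add: column_symbols_def)

lemma finite_column_symbols [simp]: "finite (column_symbols m R c)"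
  by (simp add: column_symbols_def)

text \<open>
  Each row contains \<open>s\<close> exactly once, and different rows contain it in different columns.
\<close>

lemma card_columns_with_symbol:
  assumes R: "R \<in> latin_rectangles m n" and s: "s \<in> {1..n}"
  shows "card {h \<in> {1..n}. s \<in> column_symbols m R h} = m"
proof -
  let ?pos = "\<lambda>r. inv_into {1..n} (R r) s"
  note bij = latin_rectanglesD(1)[OF R]
  have pos: "?pos r \<in> {1..n}" "R r (?pos r) = s" if "r \<in> {1..m}" for r
    using bij_betw_imp_surj_on[OF bij[OF that]] s by (metis inv_into_into, metis f_inv_into_f)
  have "{h \<in> {1..n}. s \<in> column_symbols m R h} = ?pos ` {1..m}"
  proof (intro equalityI subsetI)
    fix h assume "h \<in> {h \<in> {1..n}. s \<in> column_symbols m R h}"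
    then obtain r where r: "h \<in> {1..n}" "r \<in> {1..m}" "s = R r h"
      by (auto simp: column_symbols_def)
    then have "?pos r = h"
      using bij_betw_inv_into_left[OF bij[OF r(2)]] by simp
    then show "h \<in> ?pos ` {1..m}" using r(2) by blast
  next
    fix h assume "h \<in> ?pos ` {1..m}"
    then obtain r where "r \<in> {1..m}" "h = ?pos r" by blast
    then show "h \<in> {h \<in> {1..n}. s \<in> column_symbols m R h}"
      using pos[of r] unfolding column_symbols_def by (auto intro: rev_image_eqI)
  qed
  moreover have "inj_on ?pos {1..m}"
  proof (rule inj_onI)
    fix r r' assume r: "r \<in> {1..m}" "r' \<in> {1..m}" and eq: "?pos r = ?pos r'"
    have "R r (?pos r) = R r' (?pos r)" using pos(2) r eq by metis
    then show "r = r'"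
      using inj_onD[OF latin_rectanglesD(2)[OF R pos(1)[OF r(1)]]] r by blast
  qed
  ultimately show ?thesis by (simp add: card_image)
qed

section \<open>Switching two columns along a path\<close>

definition row_chains :: "nat \<Rightarrow> (nat \<Rightarrow> nat \<Rightarrow> nat) \<Rightarrow> nat \<Rightarrow> nat \<Rightarrow> nat list set" where
  "row_chains m R a h = {p. maximal_chain (\<lambda>r. R r a) (\<lambda>r. R r h) {1..m} p}"

text \<open>
  Exchanges the entries of columns \<open>a\<close> and \<open>h\<close> in the rows of \<open>T\<close>. With \<open>T\<close> the rows of a path
  component this is the switch behind the moment identities; with \<open>T\<close> all rows it exchanges two
  whole columns.
\<close>

definition switch :: "nat \<Rightarrow> nat \<Rightarrow> nat set \<Rightarrow> (nat \<Rightarrow> nat \<Rightarrow> nat) \<Rightarrow> nat \<Rightarrow> nat \<Rightarrow> nat" where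
  "switch a h T R = (\<lambda>r. if r \<in> T then R r \<circ> Transposition.transpose a h else R r)"

lemma switch_commute: "switch a h = switch h a"
  by (simp add: switch_def transpose_commute fun_eq_iff)

lemma switch_switch [simp]: "switch a h T (switch a h T R) = R"
  by (auto simp: switch_def fun_eq_iff)

context
  fixes m n :: nat and R a h
  assumes R: "R \<in> latin_rectangles m n" and ah: "a \<in> {1..n}" "h \<in> {1..n}" "a \<noteq> h"
begin

lemma bij_betw_row_chains_start:
  "bij_betw (\<lambda>p. R (hd p) a) (row_chains m R a h) (column_symbols m R a - column_symbols m R h)"
  unfolding row_chains_def column_symbols_def
  by (rule bij_betw_chain_start) (use latin_rectanglesD(2)[OF R] ah in auto)

lemma bij_betw_row_chains_end:
  "bij_betw (\<lambda>p. R (last p) h) (row_chains m R a h) (column_symbols m R h - column_symbols m R a)"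
  unfolding row_chains_def column_symbols_def
  by (rule bij_betw_chain_end) (use latin_rectanglesD(2)[OF R] ah in auto)

lemma finite_row_chains: "finite (row_chains m R a h)"
  using bij_betw_finite[OF bij_betw_row_chains_start] by simp

text \<open>
  Column \<open>a\<close> loses the tails and gains the heads of the path, and these two sets differ only in
  the start and the end of the path.
\<close>

lemma column_symbols_switch:
  assumes p: "p \<in> row_chains m R a h"
  shows "column_symbols m (switch a h (set p) R) a
    = insert (R (last p) h) (column_symbols m R a - {R (hd p) a})"
proof -
  let ?t = "\<lambda>r. R r a" and ?h = "\<lambda>r. R r h" and ?E = "{1..m}"
  have ch: "p \<noteq> []" "set p \<subseteq> ?E" "successively (\<lambda>e f. ?h e = ?t f) p"
    "?t (hd p) \<notin> ?h ` ?E" "?h (last p) \<notin> ?t ` ?E"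
    using p by (auto simp: row_chains_def maximal_chain_def)
  have inj: "inj_on ?t ?E" using latin_rectanglesD(2)[OF R ah(1)] .
  have set: "insert (?t (hd p)) (?h ` set p) = insert (?h (last p)) (?t ` set p)"
    using arg_cong[OF chain_tails_heads[OF ch(1,3)], of set] by simp
  have E: "?E = set p \<union> (?E - set p)" using ch(2) by blast
  have "column_symbols m (switch a h (set p) R) a
      = (\<lambda>r. switch a h (set p) R r a) ` set p \<union> (\<lambda>r. switch a h (set p) R r a) ` (?E - set p)"
    unfolding column_symbols_def by (subst E, rule image_Un)
  also have "(\<lambda>r. switch a h (set p) R r a) ` set p = ?h ` set p"
    by (rule image_cong) (simp_all add: switch_def)
  also have "(\<lambda>r. switch a h (set p) R r a) ` (?E - set p) = ?t ` (?E - set p)"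
    by (rule image_cong) (simp_all add: switch_def)
  also have "?t ` (?E - set p) = ?t ` ?E - ?t ` set p"
    using inj_on_image_set_diff[OF inj Diff_subset ch(2)] .
  also have "?h ` set p \<union> (?t ` ?E - ?t ` set p) = insert (?h (last p)) (?t ` ?E - {?t (hd p)})"
  proof -
    have "?t (hd p) \<in> ?t ` set p" using ch(1) by simp
    moreover have "?t (hd p) \<notin> ?h ` set p" using ch(2,4) by blast
    moreover have "?t ` set p \<subseteq> ?t ` ?E" using ch(2) by (rule image_mono)
    moreover have "H \<union> (E - T) = insert v (E - {u})"
      if "insert u H = insert v T" "u \<in> T" "u \<notin> H" "T \<subseteq> E" "v \<notin> E" for H T E :: "nat set" and u v
    proof -
      have "H = insert v T - {u}" using that(1,3) by (metis Diff_insert_absorb)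
      then show ?thesis using that(2,4,5) by auto
    qed
    ultimately show ?thesis using set ch(5) by metis
  qed
  finally show ?thesis by (simp add: column_symbols_def)
qed

end

lemma row_chains_rev:
  "p \<in> row_chains m R a h \<Longrightarrow> rev p \<in> row_chains m R h a"
  by (auto simp: row_chains_def intro: maximal_chain_rev)

lemma row_chain_ends:
  assumes "p \<in> row_chains m R a h"
  shows "R (hd p) a \<in> column_symbols m R a - column_symbols m R h"
    and "R (last p) h \<in> column_symbols m R h - column_symbols m R a"
proof -
  have p: "p \<noteq> []" "set p \<subseteq> {1..m}" "R (hd p) a \<notin> (\<lambda>r. R r h) ` {1..m}" "R (last p) h \<notin> (\<lambda>r. R r a) ` {1..m}"
    using assms by (auto simp: row_chains_def maximal_chain_def)
  then have "hd p \<in> {1..m}" "last p \<in> {1..m}" using hd_in_set last_in_set by blast+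
  then show "R (hd p) a \<in> column_symbols m R a - column_symbols m R h"
    "R (last p) h \<in> column_symbols m R h - column_symbols m R a"
    using p(3,4) unfolding column_symbols_def by blast+
qed

lemma row_chain_nonempty: "p \<in> row_chains m R a h \<Longrightarrow> p \<noteq> []"
  by (simp add: row_chains_def maximal_chain_def)

text \<open>
  The roles of the two columns are exchanged by reversing the chain.
\<close>

lemma column_symbols_switch_second:
  assumes "R \<in> latin_rectangles m n" "a \<in> {1..n}" "h \<in> {1..n}" "a \<noteq> h" "p \<in> row_chains m R a h"
  shows "column_symbols m (switch a h (set p) R) h
    = insert (R (hd p) a) (column_symbols m R h - {R (last p) h})"
  using column_symbols_switch[OF assms(1,3,2) _ row_chains_rev[OF assms(5)]] assms(4)
    row_chain_nonempty[OF assms(5)]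
  by (simp add: switch_commute[of h a] hd_rev last_rev)

lemma column_symbols_switch_other:
  "c \<noteq> a \<Longrightarrow> c \<noteq> h \<Longrightarrow> column_symbols m (switch a h T R) c = column_symbols m R c"
  unfolding column_symbols_def by (rule image_cong) (auto simp: switch_def)

lemma card_column_symbols_switch:
  assumes "R \<in> latin_rectangles m n" "a \<in> {1..n}" "h \<in> {1..n}" "a \<noteq> h" "p \<in> row_chains m R a h"
    and "c \<in> {1..n}"
  shows "card (column_symbols m (switch a h (set p) R) c) = m"
proof -
  note S = card_column_symbols[OF assms(1)]
  note ends = row_chain_ends[OF assms(5)]
  have swap: "card (insert y (A - {x})) = card A" if "x \<in> A" "y \<notin> A" "finite A" for x y :: nat and A
    using that by (metis card_Suc_Diff1 card_insert_disjoint finite_Diff Diff_iff)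
  show ?thesis
  proof (cases "c = a \<or> c = h")
    case True
    then show ?thesis
      using swap[of "R (hd p) a" "column_symbols m R a" "R (last p) h"]
        swap[of "R (last p) h" "column_symbols m R h" "R (hd p) a"]
        S[OF assms(2)] S[OF assms(3)] ends
      by (metis DiffD1 DiffD2 finite_column_symbols column_symbols_switch[OF assms(1-5)]
        column_symbols_switch_second[OF assms(1-5)])
  next
    case False
    then show ?thesis using S[OF assms(6)] by (simp add: column_symbols_switch_other)
  qed
qed

text \<open>
  Rows stay permutations for any set of rows, and a column of \<open>m\<close> entries has no repetition once
  it shows \<open>m\<close> symbols.
\<close>

lemma switch_in_latin_rectanglesI:
  assumes "R \<in> latin_rectangles m n" "a \<in> {1..n}" "h \<in> {1..n}"
    and sub: "T \<subseteq> {1..m}"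
    and card: "\<And>c. c \<in> {1..n} \<Longrightarrow> card (column_symbols m (switch a h T R) c) = m"
  shows "switch a h T R \<in> latin_rectangles m n"
proof -
  let ?R = "switch a h T R"
  have tr: "bij_betw (Transposition.transpose a h) {1..n} {1..n}"
    using assms(2,3) by (intro bij_betw_transpose_iff) simp
  have row: "bij_betw (?R r) {1..n} {1..n}" if "r \<in> {1..m}" for r
    using bij_betw_trans[OF tr latin_rectanglesD(1)[OF assms(1) that]]
      latin_rectanglesD(1)[OF assms(1) that] by (simp add: switch_def)
  have col: "inj_on (\<lambda>r. ?R r c) {1..m}" if "c \<in> {1..n}" for c
    using card[OF that]
    by (intro eq_card_imp_inj_on) (simp_all add: column_symbols_def)
  have ext: "R \<in> extensional {1..m}" "\<And>r. r \<in> {1..m} \<Longrightarrow> R r \<in> extensional {1..n}"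
    using assms(1) by (auto simp: latin_rectangles_def PiE_iff)
  have "?R r \<in> extensional {1..n}" if "r \<in> {1..m}" for r
    unfolding extensional_def mem_Collect_eq
  proof (intro allI impI)
    fix c assume "c \<notin> {1..n}"
    then have "c \<noteq> a" "c \<noteq> h" using assms(2,3) by auto
    then show "?R r c = undefined"
      using extensional_arb[OF ext(2)[OF that] \<open>c \<notin> {1..n}\<close>] by (simp add: switch_def)
  qed
  moreover have "?R \<in> extensional {1..m}"
    using ext(1) sub by (auto simp: switch_def extensional_def)
  moreover have "?R r c \<in> {1..n}" if "r \<in> {1..m}" "c \<in> {1..n}" for r c
    using bij_betwE[OF row[OF that(1)]] that(2) by blast
  ultimately have "?R \<in> {1..m} \<rightarrow>\<^sub>E ({1..n} \<rightarrow>\<^sub>E {1..n})"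
    unfolding PiE_iff by blast
  then show ?thesis
    unfolding latin_rectangles_def using row col by blast
qed

lemma switch_in_latin_rectangles:
  assumes "R \<in> latin_rectangles m n" "a \<in> {1..n}" "h \<in> {1..n}" "a \<noteq> h" "p \<in> row_chains m R a h"
  shows "switch a h (set p) R \<in> latin_rectangles m n"
proof (rule switch_in_latin_rectanglesI[OF assms(1-3)])
  show "set p \<subseteq> {1..m}" using assms(5) by (auto simp: row_chains_def maximal_chain_def)
qed (rule card_column_symbols_switch[OF assms])

lemma row_chains_switch:
  assumes "R \<in> latin_rectangles m n" "a \<in> {1..n}" "h \<in> {1..n}" "p \<in> row_chains m R a h"
  shows "rev p \<in> row_chains m (switch a h (set p) R) a h"
  unfolding row_chains_def mem_Collect_eq
  by (rule maximal_chain_reverse_arcs[where t = "\<lambda>r. R r a" and h = "\<lambda>r. R r h"])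
     (use assms latin_rectanglesD(2)[OF assms(1)] in \<open>auto simp: row_chains_def switch_def\<close>)

text \<open>
  The map \<open>(R, p) \<mapsto> (switch a h (set p) R, rev p)\<close> is an involution of the pairs of a Latin
  rectangle and one of its chains.
\<close>

lemma sum_switch:
  fixes F :: "(nat \<Rightarrow> nat \<Rightarrow> nat) \<Rightarrow> real"
  assumes "a \<in> {1..n}" "h \<in> {1..n}" "a \<noteq> h"
  shows "(\<Sum>R\<in>latin_rectangles m n. \<Sum>p\<in>row_chains m R a h. F (switch a h (set p) R)) =
         (\<Sum>R\<in>latin_rectangles m n. \<Sum>p\<in>row_chains m R a h. F R)"
proof -
  let ?L = "latin_rectangles m n" and ?\<phi> = "\<lambda>(R, p). (switch a h (set p) R, rev p)"
  have fin: "\<forall>R\<in>?L. finite (row_chains m R a h)"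
    using finite_row_chains assms by blast
  have "(\<Sum>(R, p)\<in>Sigma ?L (\<lambda>R. row_chains m R a h). F (switch a h (set p) R)) =
        (\<Sum>(R, p)\<in>Sigma ?L (\<lambda>R. row_chains m R a h). F R)"
    by (rule sum.reindex_bij_witness[of _ ?\<phi> ?\<phi>])
       (use assms in \<open>auto intro: switch_in_latin_rectangles row_chains_switch\<close>)
  then show ?thesis
    unfolding sum.Sigma[OF finite_latin_rectangles fin] .
qed

definition overlap :: "nat \<Rightarrow> (nat \<Rightarrow> nat \<Rightarrow> nat) \<Rightarrow> nat \<Rightarrow> nat \<Rightarrow> nat" where
  "overlap m R a b = card (column_symbols m R a \<inter> column_symbols m R b)"

text \<open>
  The switch replaces the start of the path by its end in \<open>S\<^sub>a\<close>, while \<open>S\<^sub>b\<close> is untouched.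
\<close>

lemma overlap_switch:
  assumes "R \<in> latin_rectangles m n" "a \<in> {1..n}" "h \<in> {1..n}" "a \<noteq> h" "p \<in> row_chains m R a h"
    and "b \<noteq> a" "b \<noteq> h"
  shows "real (overlap m (switch a h (set p) R) a b) = real (overlap m R a b)
    + of_bool (R (last p) h \<in> column_symbols m R b) - of_bool (R (hd p) a \<in> column_symbols m R b)"
proof -
  let ?u = "R (hd p) a" and ?v = "R (last p) h"
  let ?A = "column_symbols m R a" and ?B = "column_symbols m R b"
  have ends: "?u \<in> ?A" "?v \<notin> ?A" using row_chain_ends[OF assms(5)] by auto
  have "overlap m (switch a h (set p) R) a b = card (insert ?v (?A - {?u}) \<inter> ?B)"
    unfolding overlap_def column_symbols_switch[OF assms(1-5)]
      column_symbols_switch_other[OF assms(6,7)] ..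
  also have "insert ?v (?A - {?u}) \<inter> ?B = ((?A \<inter> ?B) - {?u}) \<union> ({?v} \<inter> ?B)" by blast
  also have "card \<dots> = card ((?A \<inter> ?B) - {?u}) + of_bool (?v \<in> ?B)"
    using ends by (subst card_Un_disjoint) auto
  also have "real \<dots> = real (overlap m R a b) + of_bool (?v \<in> ?B) - of_bool (?u \<in> ?B)"
  proof (cases "?u \<in> ?B")
    case True
    have "card (?A \<inter> ?B) > 0" using True ends by (auto simp: card_gt_0_iff)
    then show ?thesis using True ends by (simp add: overlap_def of_nat_diff card_Diff_singleton)
  qed (simp add: overlap_def)
  finally show ?thesis .
qed

section \<open>Counting path ends in the second column\<close>

text \<open>
  There is one path from each symbol of \<open>S\<^sub>a - S\<^sub>h\<close>. So each symbol of \<open>S\<^sub>a \<inter> S\<^sub>b\<close> is counted once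
  for every column \<open>h\<close> that misses it, and there are \<open>n - m\<close> of these.
\<close>

lemma sum_row_chains_start:
  assumes R: "R \<in> latin_rectangles m n" and ab: "a \<in> {1..n}" "b \<in> {1..n}" "a \<noteq> b" and "m \<le> n"
  shows "(\<Sum>h\<in>{1..n} - {a, b}. \<Sum>p\<in>row_chains m R a h. of_bool (R (hd p) a \<in> column_symbols m R b))
    = (real n - real m) * real (overlap m R a b)"
proof -
  let ?S = "column_symbols m R"
  have "(\<Sum>h\<in>{1..n} - {a, b}. \<Sum>p\<in>row_chains m R a h. of_bool (R (hd p) a \<in> ?S b))
      = (\<Sum>h\<in>{1..n} - {a, b}. \<Sum>s\<in>?S a \<inter> ?S b. of_bool (s \<notin> ?S h) :: real)"
  proof (rule sum.cong[OF refl])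
    fix h assume h: "h \<in> {1..n} - {a, b}"
    have "(\<Sum>p\<in>row_chains m R a h. of_bool (R (hd p) a \<in> ?S b)) = (\<Sum>s\<in>?S a - ?S h. of_bool (s \<in> ?S b) :: real)"
      using h by (intro sum.reindex_bij_betw[OF bij_betw_row_chains_start[OF R]] ab) auto
    also have "\<dots> = real (card ((?S a - ?S h) \<inter> ?S b))" by (simp add: sum_of_bool_eq Int_def)
    also have "(?S a - ?S h) \<inter> ?S b = (?S a \<inter> ?S b) \<inter> {s. s \<notin> ?S h}" by blast
    also have "real (card \<dots>) = (\<Sum>s\<in>?S a \<inter> ?S b. of_bool (s \<notin> ?S h))" by (simp add: sum_of_bool_eq)
    finally show "(\<Sum>p\<in>row_chains m R a h. of_bool (R (hd p) a \<in> ?S b)) = (\<Sum>s\<in>?S a \<inter> ?S b. of_bool (s \<notin> ?S h) :: real)" .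
  qed
  also have "\<dots> = (\<Sum>s\<in>?S a \<inter> ?S b. \<Sum>h\<in>{1..n} - {a, b}. of_bool (s \<notin> ?S h))"
    by (rule sum.swap)
  also have "\<dots> = (\<Sum>s\<in>?S a \<inter> ?S b. real n - real m)"
  proof (rule sum.cong[OF refl])
    fix s assume s: "s \<in> ?S a \<inter> ?S b"
    then have "s \<in> {1..n}" using column_symbols_subset[OF R ab(1)] by blast
    note deg = card_columns_with_symbol[OF R this]
    have "({1..n} - {a, b}) \<inter> {h. s \<notin> ?S h} = {1..n} - {h \<in> {1..n}. s \<in> ?S h}"
      using s by blast
    moreover have "card \<dots> = card {1..n} - card {h \<in> {1..n}. s \<in> ?S h}"
      by (rule card_Diff_subset) auto
    ultimately have "card (({1..n} - {a, b}) \<inter> {h. s \<notin> ?S h}) = n - m"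
      using deg by simp
    then show "(\<Sum>h\<in>{1..n} - {a, b}. of_bool (s \<notin> ?S h)) = real n - real m"
      using \<open>m \<le> n\<close> by (simp add: sum_of_bool_eq)
  qed
  finally show ?thesis by (simp add: overlap_def)
qed

text \<open>
  There is one path to each symbol of \<open>S\<^sub>h - S\<^sub>a\<close>. So each symbol of \<open>S\<^sub>b - S\<^sub>a\<close> is counted once
  for every column \<open>h\<close> that contains it; of these \<open>m\<close> columns, \<open>b\<close> itself is left out.
\<close>

lemma sum_row_chains_end:
  assumes R: "R \<in> latin_rectangles m n" and ab: "a \<in> {1..n}" "b \<in> {1..n}" "a \<noteq> b" and "1 \<le> m"
  shows "(\<Sum>h\<in>{1..n} - {a, b}. \<Sum>p\<in>row_chains m R a h. of_bool (R (last p) h \<in> column_symbols m R b))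
    = (real m - 1) * (real m - real (overlap m R a b))"
proof -
  let ?S = "column_symbols m R"
  have "(\<Sum>h\<in>{1..n} - {a, b}. \<Sum>p\<in>row_chains m R a h. of_bool (R (last p) h \<in> ?S b))
      = (\<Sum>h\<in>{1..n} - {a, b}. \<Sum>s\<in>?S b - ?S a. of_bool (s \<in> ?S h) :: real)"
  proof (rule sum.cong[OF refl])
    fix h assume h: "h \<in> {1..n} - {a, b}"
    have "(\<Sum>p\<in>row_chains m R a h. of_bool (R (last p) h \<in> ?S b)) = (\<Sum>s\<in>?S h - ?S a. of_bool (s \<in> ?S b) :: real)"
      using h by (intro sum.reindex_bij_betw[OF bij_betw_row_chains_end[OF R]] ab) auto
    also have "\<dots> = real (card ((?S h - ?S a) \<inter> ?S b))" by (simp add: sum_of_bool_eq Int_def)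
    also have "(?S h - ?S a) \<inter> ?S b = (?S b - ?S a) \<inter> {s. s \<in> ?S h}" by blast
    also have "real (card \<dots>) = (\<Sum>s\<in>?S b - ?S a. of_bool (s \<in> ?S h))" by (simp add: sum_of_bool_eq)
    finally show "(\<Sum>p\<in>row_chains m R a h. of_bool (R (last p) h \<in> ?S b)) = (\<Sum>s\<in>?S b - ?S a. of_bool (s \<in> ?S h) :: real)" .
  qed
  also have "\<dots> = (\<Sum>s\<in>?S b - ?S a. \<Sum>h\<in>{1..n} - {a, b}. of_bool (s \<in> ?S h))"
    by (rule sum.swap)
  also have "\<dots> = (\<Sum>s\<in>?S b - ?S a. real m - 1)"
  proof (rule sum.cong[OF refl])
    fix s assume s: "s \<in> ?S b - ?S a"
    then have "s \<in> {1..n}" using column_symbols_subset[OF R ab(2)] by blast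
    note deg = card_columns_with_symbol[OF R this]
    have "({1..n} - {a, b}) \<inter> {h. s \<in> ?S h} = {h \<in> {1..n}. s \<in> ?S h} - {b}"
      using s by blast
    then have "card (({1..n} - {a, b}) \<inter> {h. s \<in> ?S h}) = m - 1"
      using deg s ab by (simp add: card_Diff_singleton)
    then show "(\<Sum>h\<in>{1..n} - {a, b}. of_bool (s \<in> ?S h)) = real m - 1"
      using \<open>1 \<le> m\<close> by (simp add: sum_of_bool_eq)
  qed
  also have "\<dots> = (real m - 1) * real (card (?S b - ?S a))" by simp
  also have "real (card (?S b - ?S a)) = real m - real (overlap m R a b)"
    using card_Diff_subset_Int[of "?S b" "?S a"] card_column_symbols[OF R ab(2)]
      card_mono[of "?S b" "?S a \<inter> ?S b"]
    by (simp add: overlap_def Int_commute of_nat_diff)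
  finally show ?thesis .
qed

text \<open>
  The blocker count ranges over all \<open>h \<noteq> a\<close>, but \<open>h = b\<close> contributes nothing: a path of the
  \<open>(a, b)\<close>-digraph starts at a symbol outside \<open>S\<^sub>b\<close>.
\<close>

lemma blocker_count_eq_sum_row_chains:
  assumes R: "R \<in> latin_rectangles m n" and ab: "a \<in> {1..n}" "b \<in> {1..n}" "a \<noteq> b"
  shows "real (blocker_count m n a b R) = (\<Sum>h\<in>{1..n} - {a, b}. \<Sum>p\<in>row_chains m R a h.
    of_bool (R (hd p) a \<in> column_symbols m R b) * of_bool (R (last p) h \<in> column_symbols m R b))"
proof -
  let ?S = "column_symbols m R"
  let ?G = "column_digraph m n R a"
  let ?P = "\<lambda>h. {p \<in> row_chains m R a h. {R (hd p) a, R (last p) h} \<subseteq> ?S b}"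
  let ?Q = "\<lambda>h. {Q. path_component (?G h) Q \<and> path_ends Q \<subseteq> ?S b}"
  have card: "card (?Q h) = card (?P h)" and fin: "finite (?Q h)" if h: "h \<in> {1..n} - {a}" for h
  proof -
    have wf: "wf_digraph (?G h)"
    proof unfold_locales
      fix r assume "r \<in> arcs (?G h)"
      then have "r \<in> {1..m}" by (simp add: column_digraph_def)
      from bij_betwE[OF latin_rectanglesD(1)[OF R this]]
      show "tail (?G h) r \<in> verts (?G h)" "head (?G h) r \<in> verts (?G h)"
        using ab h by (simp_all add: column_digraph_def)
    qed
    have "bij_betw (chain_graph (?G h)) (?P h) (?Q h)"
      using bij_betw_chain_path_components[OF wf, of "?S b"] latin_rectanglesD(2)[OF R] ab h
      by (simp add: column_digraph_def row_chains_def)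
    then show "card (?Q h) = card (?P h)" "finite (?Q h)"
      using bij_betw_same_card bij_betw_finite finite_row_chains[OF R ab(1), of h] h by fastforce+
  qed
  have "blocker_count m n a b R = card (Sigma ({1..n} - {a}) ?Q)"
    unfolding blocker_count_def by (rule arg_cong[of _ _ card]) auto
  also have "\<dots> = (\<Sum>h\<in>{1..n} - {a}. card (?Q h))"
    using fin by (intro card_SigmaI) auto
  also have "\<dots> = (\<Sum>h\<in>{1..n} - {a}. card (?P h))"
    using card by (intro sum.cong) auto
  also have "\<dots> = (\<Sum>h\<in>{1..n} - {a, b}. card (?P h))"
  proof (rule sum.mono_neutral_right)
    have "?P b = {}" using row_chain_ends(1)[of _ m R a b] by auto
    then have "card (?P b) = 0" by (simp only: card.empty)
    then show "\<forall>h\<in>{1..n} - {a} - ({1..n} - {a, b}). card (?P h) = 0" by auto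
  qed auto
  finally have "blocker_count m n a b R = (\<Sum>h\<in>{1..n} - {a, b}. card (?P h))" .
  then have "real (blocker_count m n a b R) = (\<Sum>h\<in>{1..n} - {a, b}. real (card (?P h)))"
    by simp
  also have "\<dots> = (\<Sum>h\<in>{1..n} - {a, b}. \<Sum>p\<in>row_chains m R a h.
      of_bool (R (hd p) a \<in> ?S b) * of_bool (R (last p) h \<in> ?S b))"
  proof (rule sum.cong[OF refl])
    fix h assume h: "h \<in> {1..n} - {a, b}"
    then have "finite (row_chains m R a h)" using finite_row_chains[OF R ab(1), of h] by auto
    then have "(\<Sum>p\<in>row_chains m R a h. of_bool (R (hd p) a \<in> ?S b \<and> R (last p) h \<in> ?S b)) = real (card (?P h))"
      by (simp add: sum_of_bool_eq Int_def)
    then show "real (card (?P h)) = (\<Sum>p\<in>row_chains m R a h.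
      of_bool (R (hd p) a \<in> ?S b) * of_bool (R (last p) h \<in> ?S b))"
      by (simp add: of_bool_conj)
  qed
  finally show ?thesis .
qed

section \<open>Moments of the overlap of two columns\<close>

lemma sum_overlap_increments:
  fixes f :: "nat \<Rightarrow> real"
  assumes "a \<in> {1..n}" "b \<in> {1..n}" "a \<noteq> b"
  shows "(\<Sum>R\<in>latin_rectangles m n. \<Sum>h\<in>{1..n} - {a, b}. \<Sum>p\<in>row_chains m R a h.
    f (overlap m (switch a h (set p) R) a b) - f (overlap m R a b)) = 0"
proof -
  have "(\<Sum>R\<in>latin_rectangles m n. \<Sum>h\<in>{1..n} - {a, b}. \<Sum>p\<in>row_chains m R a h.
      f (overlap m (switch a h (set p) R) a b) - f (overlap m R a b)) =
    (\<Sum>h\<in>{1..n} - {a, b}. \<Sum>R\<in>latin_rectangles m n. \<Sum>p\<in>row_chains m R a h.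
      f (overlap m (switch a h (set p) R) a b) - f (overlap m R a b))"
    by (rule sum.swap)
  also have "\<dots> = 0"
  proof (rule sum.neutral, rule ballI)
    fix h assume "h \<in> {1..n} - {a, b}"
    then show "(\<Sum>R\<in>latin_rectangles m n. \<Sum>p\<in>row_chains m R a h.
        f (overlap m (switch a h (set p) R) a b) - f (overlap m R a b)) = 0"
      using sum_switch[of a n h "\<lambda>R. f (overlap m R a b)" m] assms
      unfolding sum_subtractf by auto
  qed
  finally show ?thesis .
qed

text \<open>
  With \<open>u\<close> and \<open>v\<close> the indicators of the start and of the end of the path lying in \<open>S\<^sub>b\<close>, the
  switch changes the overlap \<open>X\<close> by \<open>v - u\<close>. The two identities are the vanishing of the total
  change of \<open>X\<close> and of \<open>X\<^sup>2\<close>; the product \<open>u v\<close> in the second one is what counts blockers.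
\<close>

lemma sum_overlap_drift:
  assumes ab: "a \<in> {1..n}" "b \<in> {1..n}" "a \<noteq> b" and m: "1 \<le> m" "m \<le> n"
  shows "(\<Sum>R\<in>latin_rectangles m n. (real m - 1) * (real m - real (overlap m R a b))
      - (real n - real m) * real (overlap m R a b)) = 0" (is ?first)
    and "(\<Sum>R\<in>latin_rectangles m n.
      2 * real (overlap m R a b) * ((real m - 1) * (real m - real (overlap m R a b))
        - (real n - real m) * real (overlap m R a b))
      + ((real m - 1) * (real m - real (overlap m R a b)) + (real n - real m) * real (overlap m R a b))
      - 2 * real (blocker_count m n a b R)) = 0" (is ?second)
proof -
  let ?L = "latin_rectangles m n" and ?H = "{1..n} - {a, b}"
  let ?u = "\<lambda>R h p. of_bool (R (hd p) a \<in> column_symbols m R b) :: real"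
  let ?v = "\<lambda>R h p. of_bool (R (last p) h \<in> column_symbols m R b) :: real"
  let ?X = "\<lambda>R. real (overlap m R a b)"
  have step: "real (overlap m (switch a h (set p) R) a b) = ?X R + ?v R h p - ?u R h p"
    if "R \<in> ?L" "h \<in> ?H" "p \<in> row_chains m R a h" for R h p
    using overlap_switch[of R m n a h p b] that ab by auto
  note U = sum_row_chains_start[OF _ ab m(2)] and V = sum_row_chains_end[OF _ ab m(1)]
    and B = blocker_count_eq_sum_row_chains[OF _ ab]
  have "(\<Sum>R\<in>?L. \<Sum>h\<in>?H. \<Sum>p\<in>row_chains m R a h. ?v R h p - ?u R h p) = 0"
  proof -
    have "(\<Sum>R\<in>?L. \<Sum>h\<in>?H. \<Sum>p\<in>row_chains m R a h. ?v R h p - ?u R h p)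
      = (\<Sum>R\<in>?L. \<Sum>h\<in>?H. \<Sum>p\<in>row_chains m R a h. real (overlap m (switch a h (set p) R) a b) - ?X R)"
      by (intro sum.cong refl) (simp only: step)
    also have "\<dots> = 0" by (rule sum_overlap_increments[OF ab])
    finally show ?thesis .
  qed
  then show ?first
    by (simp only: sum_subtractf U V cong: sum.cong)
  have "(\<Sum>R\<in>?L. \<Sum>h\<in>?H. \<Sum>p\<in>row_chains m R a h.
      2 * ?X R * (?v R h p - ?u R h p) + (?v R h p + ?u R h p) - 2 * (?u R h p * ?v R h p)) = 0"
  proof -
    have "(\<Sum>R\<in>?L. \<Sum>h\<in>?H. \<Sum>p\<in>row_chains m R a h.
        2 * ?X R * (?v R h p - ?u R h p) + (?v R h p + ?u R h p) - 2 * (?u R h p * ?v R h p))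
      = (\<Sum>R\<in>?L. \<Sum>h\<in>?H. \<Sum>p\<in>row_chains m R a h. (real (overlap m (switch a h (set p) R) a b))\<^sup>2 - (?X R)\<^sup>2)"
    proof (intro sum.cong refl)
      fix R h p assume A: "R \<in> ?L" "h \<in> ?H" "p \<in> row_chains m R a h"
      \<comment> \<open>Indicators are idempotent, which turns the square of the increment into a linear term.\<close>
      have "2 * x * (v - u) + (v + u) - 2 * (u * v) = (x + v - u)\<^sup>2 - x\<^sup>2"
        if "u\<^sup>2 = u" "v\<^sup>2 = v" for u v x :: real
      proof -
        have "(x + v - u)\<^sup>2 - x\<^sup>2 = 2 * x * (v - u) + (v\<^sup>2 + u\<^sup>2) - 2 * (u * v)"
          by (simp add: power2_eq_square algebra_simps)
        then show ?thesis using that by simp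
      qed
      moreover have "(?u R h p)\<^sup>2 = ?u R h p" "(?v R h p)\<^sup>2 = ?v R h p" by simp_all
      ultimately show "2 * ?X R * (?v R h p - ?u R h p) + (?v R h p + ?u R h p) - 2 * (?u R h p * ?v R h p)
        = (real (overlap m (switch a h (set p) R) a b))\<^sup>2 - (?X R)\<^sup>2"
        unfolding step[OF A] by blast
    qed
    also have "\<dots> = 0" using sum_overlap_increments[OF ab, of "\<lambda>x. (real x)\<^sup>2"] .
    finally show ?thesis .
  qed
  then show ?second
    by (simp only: sum_subtractf sum.distrib sum_distrib_left[symmetric] U V B cong: sum.cong)
qed

text \<open>
  A name for the expectation, so that the rules below rewrite it without side conditions on
  integrability.
\<close>

definition average :: "nat \<Rightarrow> nat \<Rightarrow> ((nat \<Rightarrow> nat \<Rightarrow> nat) \<Rightarrow> real) \<Rightarrow> real" where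
  "average m n = measure_pmf.expectation (random_latin_rectangle m n)"

lemma average_eq_sum:
  assumes "m \<le> n"
  shows "average m n F = (\<Sum>R\<in>latin_rectangles m n. F R) / real (card (latin_rectangles m n))"
  unfolding average_def random_latin_rectangle_def
  using latin_rectangles_nonempty[OF assms] finite_latin_rectangles by (rule integral_pmf_of_set)

lemma average_cong:
  assumes "m \<le> n" "\<And>R. R \<in> latin_rectangles m n \<Longrightarrow> F R = G R"
  shows "average m n F = average m n G"
  using assms by (simp add: average_eq_sum cong: sum.cong)

lemma average_linear:
  assumes "m \<le> n"
  shows "average m n (\<lambda>R. F R + G R) = average m n F + average m n G"
    "average m n (\<lambda>R. F R - G R) = average m n F - average m n G"
    "average m n (\<lambda>R. k * F R) = k * average m n F"
    "average m n (\<lambda>R. k) = k"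
    "average m n (\<lambda>R. \<Sum>i\<in>I. H i R) = (\<Sum>i\<in>I. average m n (H i))"
proof -
  have "card (latin_rectangles m n) > 0"
    using latin_rectangles_nonempty[OF assms] finite_latin_rectangles by (simp add: card_gt_0_iff)
  then show "average m n (\<lambda>R. k) = k"
    by (simp add: average_eq_sum[OF assms])
  have "average m n (\<lambda>R. \<Sum>i\<in>I. H i R) = (\<Sum>i\<in>I. \<Sum>R\<in>latin_rectangles m n. H i R) / real (card (latin_rectangles m n))"
    unfolding average_eq_sum[OF assms] by (subst sum.swap) (rule refl)
  then show "average m n (\<lambda>R. \<Sum>i\<in>I. H i R) = (\<Sum>i\<in>I. average m n (H i))"
    by (simp add: average_eq_sum[OF assms] sum_divide_distrib)
qed (simp_all add: average_eq_sum[OF assms] sum.distrib sum_subtractf sum_distrib_left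
  add_divide_distrib diff_divide_distrib)

text \<open>
  The drift identities are linear equations for the first two moments of the overlap: the first
  one determines the mean, and the second one then the second moment.
\<close>

lemma average_overlap_moments:
  assumes ab: "a \<in> {1..n}" "b \<in> {1..n}" "a \<noteq> b" and m: "1 \<le> m" "m \<le> n"
  shows "(real n - 1) * average m n (\<lambda>R. real (overlap m R a b)) = real m * (real m - 1)"
    and "(real n - 1) * average m n (\<lambda>R. (real (overlap m R a b))\<^sup>2) =
      ((real m * (real m - 1))\<^sup>2 + (real n - real m) * (real m * (real m - 1))) / (real n - 1)
      - average m n (\<lambda>R. real (blocker_count m n a b R))"
proof -
  let ?X = "\<lambda>R. real (overlap m R a b)" and ?B = "\<lambda>R. real (blocker_count m n a b R)"
  let ?E = "average m n"
  note lin = average_linear[OF m(2)]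
  have n: "real n - 1 > 0" using ab by auto
  have "?E (\<lambda>R. (real m - 1) * (real m - ?X R) - (real n - real m) * ?X R) = 0"
    unfolding average_eq_sum[OF m(2)] sum_overlap_drift(1)[OF ab m] by simp
  then show first: "(real n - 1) * ?E ?X = real m * (real m - 1)"
    unfolding lin by (simp add: algebra_simps)
  have "?E (\<lambda>R. 2 * ?X R * ((real m - 1) * (real m - ?X R) - (real n - real m) * ?X R)
      + ((real m - 1) * (real m - ?X R) + (real n - real m) * ?X R) - 2 * ?B R) = 0"
    unfolding average_eq_sum[OF m(2)] sum_overlap_drift(2)[OF ab m] by simp
  also have "(\<lambda>R. 2 * ?X R * ((real m - 1) * (real m - ?X R) - (real n - real m) * ?X R)
      + ((real m - 1) * (real m - ?X R) + (real n - real m) * ?X R) - 2 * ?B R)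
    = (\<lambda>R. (2 * real m * (real m - 1) - (real m - 1) + (real n - real m)) * ?X R
      - 2 * (real n - 1) * (?X R)\<^sup>2 + real m * (real m - 1) - 2 * ?B R)"
    by (rule ext) (simp add: power2_eq_square algebra_simps)
  finally have "2 * ((real n - 1) * ?E (\<lambda>R. (?X R)\<^sup>2)) =
    (2 * real m * (real m - 1) - (real m - 1) + (real n - real m)) * ?E ?X + real m * (real m - 1) - 2 * ?E ?B"
    unfolding lin by (simp add: algebra_simps)
  moreover have "?E ?X = real m * (real m - 1) / (real n - 1)"
    using first n by (simp add: field_simps)
  ultimately have "2 * ((real n - 1) * ?E (\<lambda>R. (?X R)\<^sup>2)) =
    (2 * real m * (real m - 1) - (real m - 1) + (real n - real m)) * (real m * (real m - 1) / (real n - 1))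
      + real m * (real m - 1) - 2 * ?E ?B" by simp
  moreover have "(2 * real m * (real m - 1) - (real m - 1) + (real n - real m)) * (real m * (real m - 1) / (real n - 1))
      + real m * (real m - 1)
    = 2 * (((real m * (real m - 1))\<^sup>2 + (real n - real m) * (real m * (real m - 1))) / (real n - 1))"
  proof -
    have "(2 * x - (y - 1) + d) * (x / N) + x = 2 * ((x\<^sup>2 + d * x) / N)" if "N = y - 1 + d" "N \<noteq> 0" for x y d N :: real
    proof -
      have "x = N * x / N" using that by simp
      then have "(2 * x - (y - 1) + d) * (x / N) + x = ((2 * x - (y - 1) + d) * x + N * x) / N"
        by (metis add_divide_distrib times_divide_eq_right)
      also have "(2 * x - (y - 1) + d) * x + N * x = 2 * (x\<^sup>2 + d * x)"
        unfolding that(1) by (simp add: power2_eq_square algebra_simps)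
      finally show ?thesis by simp
    qed
    from this[of "real n - 1" "real m" "real n - real m" "real m * (real m - 1)"] n
    show ?thesis by (simp add: mult.assoc)
  qed
  ultimately show "(real n - 1) * ?E (\<lambda>R. (?X R)\<^sup>2) =
      ((real m * (real m - 1))\<^sup>2 + (real n - real m) * (real m * (real m - 1))) / (real n - 1) - ?E ?B"
    by linarith
qed



section \<open>Exchangeability of the columns\<close>

lemma column_symbols_swap_columns:
  "c \<in> {1..n} \<Longrightarrow> column_symbols m (switch i j {1..m} R) c = column_symbols m R (Transposition.transpose i j c)"
  unfolding column_symbols_def by (rule image_cong) (simp_all add: switch_def)

lemma swap_columns_in_latin_rectangles:
  assumes "R \<in> latin_rectangles m n" "i \<in> {1..n}" "j \<in> {1..n}"
  shows "switch i j {1..m} R \<in> latin_rectangles m n"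
proof (rule switch_in_latin_rectanglesI[OF assms])
  fix c assume c: "c \<in> {1..n}"
  then have "Transposition.transpose i j c \<in> {1..n}"
    using assms(2,3) by (auto simp: Transposition.transpose_def)
  then show "card (column_symbols m (switch i j {1..m} R) c) = m"
    using card_column_symbols[OF assms(1)] by (simp only: column_symbols_swap_columns[OF c])
qed simp

lemma average_swap_columns:
  assumes "m \<le> n" "i \<in> {1..n}" "j \<in> {1..n}"
  shows "average m n (\<lambda>R. F (switch i j {1..m} R)) = average m n F"
proof -
  have "(\<Sum>R\<in>latin_rectangles m n. F (switch i j {1..m} R)) = (\<Sum>R\<in>latin_rectangles m n. F R)"
    by (rule sum.reindex_bij_witness[of _ "switch i j {1..m}" "switch i j {1..m}"])
       (simp_all add: swap_columns_in_latin_rectangles[OF _ assms(2,3)] del: One_nat_def)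
  then show ?thesis by (simp add: average_eq_sum[OF assms(1)])
qed

lemma overlap_commute: "overlap m R a b = overlap m R b a"
  by (simp add: overlap_def Int_commute)

text \<open>
  Swapping two columns preserves the uniform distribution, and any two pairs of distinct columns
  are related by such swaps and the symmetry of the overlap.
\<close>

lemma average_overlap_exchangeable:
  assumes "m \<le> n" "a \<in> {1..n}" "b \<in> {1..n}" "a \<noteq> b" "i \<in> {1..n}" "j \<in> {1..n}" "i \<noteq> j"
  shows "average m n (\<lambda>R. g (overlap m R i j)) = average m n (\<lambda>R. g (overlap m R a b))"
proof -
  let ?e = "\<lambda>x y. average m n (\<lambda>R. g (overlap m R x y))"
  have sym: "?e x y = ?e y x" for x y
    using overlap_commute[of m _ x y] by simp
  have move: "?e x y = ?e x z" if "x \<in> {1..n}" "y \<in> {1..n}" "z \<in> {1..n}" "y \<noteq> x" "z \<noteq> x" for x y z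
  proof -
    have "overlap m (switch y z {1..m} R) x y = overlap m R x z" for R
      using that by (simp only: overlap_def column_symbols_swap_columns) simp
    then show ?thesis
      using average_swap_columns[OF assms(1) that(2,3), of "\<lambda>R. g (overlap m R x y)"] by simp
  qed
  show ?thesis
  proof (cases "j = a")
    case True
    then show ?thesis using move[of a b i] sym[of i a] assms by auto
  next
    case False
    have "?e a b = ?e a j" using move[of a b j] False assms by auto
    also have "\<dots> = ?e j i" using sym[of a j] move[of j a i] False assms by auto
    finally show ?thesis using sym[of i j] by simp
  qed
qed

section \<open>The trace as a sum over pairs of columns\<close>

text \<open>
  The sum on the right is the trace of \<open>(C C\<^sup>T)\<^sup>2\<close>, that is, the sum of the squared inner products
  of the rows of \<open>C\<close>.
\<close>

lemma mat_trace_gram_square: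
  fixes C :: "real mat"
  assumes C: "C \<in> carrier_mat n n"
  shows "mat_trace ((transpose_mat C * C) ^\<^sub>m 2) = (\<Sum>i<n. \<Sum>j<n. (\<Sum>k<n. C $$ (i, k) * C $$ (j, k))\<^sup>2)"
proof -
  let ?A = "transpose_mat C * C"
  let ?c = "\<lambda>i k. C $$ (i, k)"
  have A: "?A \<in> carrier_mat n n" using C by simp
  have entry: "?A $$ (k, l) = (\<Sum>i<n. ?c i k * ?c i l)" if "k < n" "l < n" for k l
    using C that by (simp add: scalar_prod_def atLeast0LessThan)
  have "?A ^\<^sub>m 2 = ?A * ?A"
    using A by (simp add: numeral_2_eq_2)
  then have square: "mat_trace (?A ^\<^sub>m 2) = mat_trace (?A * ?A)" by (rule arg_cong)
  have trace_square: "mat_trace (A * A) = (\<Sum>k<n. \<Sum>l<n. A $$ (k, l) * A $$ (l, k))"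
    if "A \<in> carrier_mat n n" for A :: "real mat"
    using that by (simp add: mat_trace_def scalar_prod_def atLeast0LessThan)
  have "mat_trace (?A ^\<^sub>m 2) = (\<Sum>k<n. \<Sum>l<n. ?A $$ (k, l) * ?A $$ (l, k))"
    using square trace_square[OF A] by (rule trans)
  also have "\<dots> = (\<Sum>k<n. \<Sum>l<n. \<Sum>i<n. \<Sum>j<n. (?c i k * ?c j k) * (?c i l * ?c j l))"
    by (simp add: entry sum_product mult_ac)
  \<comment> \<open>The sums over \<open>l\<close> and then over \<open>k\<close> are moved inside those over \<open>i\<close> and \<open>j\<close>.\<close>
  also have "\<dots> = (\<Sum>k<n. \<Sum>i<n. \<Sum>j<n. \<Sum>l<n. (?c i k * ?c j k) * (?c i l * ?c j l))"
    by (subst sum.swap, subst (2) sum.swap) (rule refl)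
  also have "\<dots> = (\<Sum>i<n. \<Sum>j<n. \<Sum>k<n. \<Sum>l<n. (?c i k * ?c j k) * (?c i l * ?c j l))"
    by (subst sum.swap, subst (2) sum.swap) (rule refl)
  also have "\<dots> = (\<Sum>i<n. \<Sum>j<n. (\<Sum>k<n. ?c i k * ?c j k)\<^sup>2)"
    by (simp add: power2_eq_square sum_product)
  finally show ?thesis .
qed

lemma centred_matrix_carrier [simp]: "centred_matrix m n R \<in> carrier_mat n n"
  unfolding centred_matrix_def
  by (intro minus_carrier_mat smult_carrier_mat
      mult_carrier_mat[where n = "length [ones_vec n]"] mat_of_cols_carrier mat_of_rows_carrier)

lemma centred_matrix_entry:
  assumes "i < n" "k < n"
  shows "centred_matrix m n R $$ (i, k) = of_bool (Suc k \<in> column_symbols m R (Suc i)) - real m / real n"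
  using assms
  by (simp add: centred_matrix_def used_matrix_def ones_vec_def mat_of_cols_def mat_of_rows_def scalar_prod_def)

text \<open>
  Every \<open>S\<^sub>i\<close> has \<open>m\<close> elements, so centring subtracts the constant \<open>m\<^sup>2 / n\<close> from the inner product
  of the indicator vectors of \<open>S\<^sub>i\<close> and \<open>S\<^sub>j\<close>.
\<close>

lemma trace_stat_eq_overlaps:
  assumes R: "R \<in> latin_rectangles m n" and n: "1 \<le> n"
  shows "trace_stat m n R = (\<Sum>i\<in>{1..n}. \<Sum>j\<in>{1..n}. (real (overlap m R i j) - (real m)\<^sup>2 / real n)\<^sup>2)"
proof -
  let ?S = "column_symbols m R"
  have gram: "(\<Sum>k<n. centred_matrix m n R $$ (i, k) * centred_matrix m n R $$ (j, k))
      = real (overlap m R (Suc i) (Suc j)) - (real m)\<^sup>2 / real n" if ij: "i < n" "j < n" for i j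
  proof -
    have S: "?S (Suc i) \<subseteq> {1..n}" "?S (Suc j) \<subseteq> {1..n}" "card (?S (Suc i)) = m" "card (?S (Suc j)) = m"
      using column_symbols_subset[OF R] card_column_symbols[OF R] ij by auto
    have count: "(\<Sum>s\<in>{1..n}. of_bool (s \<in> A)) = real (card A)" if "A \<subseteq> {1..n}" for A
      using that by (simp add: sum_of_bool_eq Int_absorb1 del: sum.cl_ivl_Suc)
    have "(\<Sum>k<n. centred_matrix m n R $$ (i, k) * centred_matrix m n R $$ (j, k))
      = (\<Sum>k<n. (of_bool (Suc k \<in> ?S (Suc i)) - real m / real n) * (of_bool (Suc k \<in> ?S (Suc j)) - real m / real n))"
      using ij by (simp add: centred_matrix_entry)
    also have "\<dots> = (\<Sum>s\<in>{1..n}. (of_bool (s \<in> ?S (Suc i)) - real m / real n) * (of_bool (s \<in> ?S (Suc j)) - real m / real n))"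
      by (rule sum.reindex_bij_witness[of _ "\<lambda>s. s - 1" Suc]) auto
    also have "\<dots> = (\<Sum>s\<in>{1..n}. of_bool (s \<in> ?S (Suc i) \<inter> ?S (Suc j))
        - real m / real n * of_bool (s \<in> ?S (Suc i)) - real m / real n * of_bool (s \<in> ?S (Suc j))
        + (real m / real n)\<^sup>2)"
      by (rule sum.cong[OF refl]) (simp add: power2_eq_square algebra_simps)
    also have "\<dots> = real (overlap m R (Suc i) (Suc j)) - real m / real n * real m
        - real m / real n * real m + real n * (real m / real n)\<^sup>2"
      using S count[of "?S (Suc i) \<inter> ?S (Suc j)"] count[OF S(1)] count[OF S(2)]
      by (simp only: sum.distrib sum_subtractf sum_distrib_left[symmetric] overlap_def) auto
    also have "\<dots> = real (overlap m R (Suc i) (Suc j)) - (real m)\<^sup>2 / real n"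
      using n by (simp add: power2_eq_square)
    finally show ?thesis .
  qed
  have "trace_stat m n R = (\<Sum>i<n. \<Sum>j<n. (real (overlap m R (Suc i) (Suc j)) - (real m)\<^sup>2 / real n)\<^sup>2)"
    unfolding trace_stat_def mat_trace_gram_square[OF centred_matrix_carrier]
    by (intro sum.cong refl) (simp add: gram)
  also have "\<dots> = (\<Sum>i\<in>{1..n}. \<Sum>j\<in>{1..n}. (real (overlap m R i j) - (real m)\<^sup>2 / real n)\<^sup>2)"
    unfolding image_Suc_lessThan[symmetric] by (simp add: sum.reindex)
  finally show ?thesis .
qed

section \<open>The trace moment and its bound\<close>

text \<open>
  The \<open>n\<close> diagonal pairs contribute the constant \<open>(m - m\<^sup>2 / n)\<^sup>2\<close>, and by exchangeability the
  \<open>n (n - 1)\<close> other pairs have the same mean; the rest is algebra.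
\<close>

lemma average_trace_stat:
  assumes m: "1 \<le> m" "m < n" and ab: "a \<in> {1..n}" "b \<in> {1..n}" "a \<noteq> b"
  shows "average m n (trace_stat m n) =
    (real n * real m * (real m - 1) * (real n - real m) + (real m)\<^sup>2 * (real n - real m)\<^sup>2) / (real n - 1)
    - real n * average m n (\<lambda>R. real (blocker_count m n a b R))"
proof -
  have mn: "m \<le> n" using m by simp
  note lin = average_linear[OF mn]
  let ?\<mu> = "(real m)\<^sup>2 / real n" and ?B = "average m n (\<lambda>R. real (blocker_count m n a b R))"
  let ?X = "\<lambda>R. real (overlap m R a b)"
  define V where "V = average m n (\<lambda>R. (?X R - ?\<mu>)\<^sup>2)"
  have n: "real n > 1" using m by simp
  have diag: "average m n (\<lambda>R. (real (overlap m R i i) - ?\<mu>)\<^sup>2) = (real m - ?\<mu>)\<^sup>2" if "i \<in> {1..n}" for i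
  proof -
    have "average m n (\<lambda>R. (real (overlap m R i i) - ?\<mu>)\<^sup>2) = average m n (\<lambda>R. (real m - ?\<mu>)\<^sup>2)"
      using card_column_symbols[OF _ that] by (intro average_cong[OF mn]) (simp add: overlap_def)
    then show ?thesis by (simp add: lin(4))
  qed
  have row: "(\<Sum>j\<in>{1..n}. average m n (\<lambda>R. (real (overlap m R i j) - ?\<mu>)\<^sup>2)) = (real m - ?\<mu>)\<^sup>2 + (real n - 1) * V"
    if i: "i \<in> {1..n}" for i
  proof -
    have "(\<Sum>j\<in>{1..n} - {i}. average m n (\<lambda>R. (real (overlap m R i j) - ?\<mu>)\<^sup>2)) = (\<Sum>j\<in>{1..n} - {i}. V)"
      unfolding V_def
      by (rule sum.cong[OF refl],
        rule average_overlap_exchangeable[OF mn ab i, where g = "\<lambda>x. (real x - ?\<mu>)\<^sup>2"]) auto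
    also have "\<dots> = (real n - 1) * V"
      using i m by (simp add: card_Diff_singleton of_nat_diff)
    finally show ?thesis
      using sum.remove[OF finite_atLeastAtMost i, of "\<lambda>j. average m n (\<lambda>R. (real (overlap m R i j) - ?\<mu>)\<^sup>2)"]
        diag[OF i] by simp
  qed
  have "average m n (trace_stat m n)
      = average m n (\<lambda>R. \<Sum>i\<in>{1..n}. \<Sum>j\<in>{1..n}. (real (overlap m R i j) - ?\<mu>)\<^sup>2)"
    using m by (intro average_cong[OF mn] trace_stat_eq_overlaps) auto
  also have "\<dots> = (\<Sum>i\<in>{1..n}. (real m - ?\<mu>)\<^sup>2 + (real n - 1) * V)"
    unfolding lin(5) using row by (intro sum.cong refl) auto
  also have "\<dots> = real n * ((real m - ?\<mu>)\<^sup>2 + (real n - 1) * V)" by simp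
  also have "(real n - 1) * V = (real n - 1) * average m n (\<lambda>R. (?X R)\<^sup>2)
      - 2 * ?\<mu> * ((real n - 1) * average m n ?X) + (real n - 1) * ?\<mu>\<^sup>2"
  proof -
    have "V = average m n (\<lambda>R. (?X R)\<^sup>2 - 2 * ?\<mu> * ?X R + ?\<mu>\<^sup>2)"
      unfolding V_def by (rule average_cong[OF mn]) (simp add: power2_eq_square algebra_simps)
    then have V: "V = average m n (\<lambda>R. (?X R)\<^sup>2) - 2 * ?\<mu> * average m n ?X + ?\<mu>\<^sup>2"
      unfolding lin .
    have "N * (x - 2 * y * z + w) = N * x - 2 * y * (N * z) + N * w" for N x y z w :: real
      by (simp add: algebra_simps)
    then show ?thesis unfolding V .
  qed
  also have "\<dots> = (((real m * (real m - 1))\<^sup>2 + (real n - real m) * (real m * (real m - 1))) / (real n - 1) - ?B)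
      - 2 * ?\<mu> * (real m * (real m - 1)) + (real n - 1) * ?\<mu>\<^sup>2"
    unfolding average_overlap_moments[OF ab m(1) mn] ..
  also have "real n * ((real m - ?\<mu>)\<^sup>2 + \<dots>) =
    (real n * real m * (real m - 1) * (real n - real m) + (real m)\<^sup>2 * (real n - real m)\<^sup>2) / (real n - 1)
    - real n * ?B"
  proof -
    have "N * ((x - x\<^sup>2 / N)\<^sup>2 + (((x * (x - 1))\<^sup>2 + (N - x) * (x * (x - 1))) / (N - 1) - B
        - 2 * (x\<^sup>2 / N) * (x * (x - 1)) + (N - 1) * (x\<^sup>2 / N)\<^sup>2)) =
      (N * x * (x - 1) * (N - x) + x\<^sup>2 * (N - x)\<^sup>2) / (N - 1) - N * B" if "N > 1" for N x B :: real
    proof -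
      have "N \<noteq> 0" "N - 1 \<noteq> 0" using that by auto
      then show ?thesis
        by (simp add: divide_simps) (simp add: power2_eq_square power4_eq_xxxx algebra_simps)
    qed
    from this[OF n] show ?thesis .
  qed
  finally show ?thesis .
qed

lemma centred_matrix_extreme:
  assumes R: "R \<in> latin_rectangles m n" and n: "1 \<le> n" and m: "m = 0 \<or> m = n"
  shows "centred_matrix m n R = 0\<^sub>m n n"
proof (rule eq_matI)
  fix i j assume "i < dim_row (0\<^sub>m n n)" "j < dim_col (0\<^sub>m n n)"
  then have ij: "i < n" "j < n" by auto
  have "column_symbols m R (Suc i) = (if m = 0 then {} else {1..n})"
  proof (cases "m = 0")
    case True
    then show ?thesis by (simp add: column_symbols_def)
  next
    case False
    then have "m = n" using m by simp
    then show ?thesis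
      using card_subset_eq[OF _ column_symbols_subset[OF R, of "Suc i"]]
        card_column_symbols[OF R, of "Suc i"] ij by auto
  qed
  then show "centred_matrix m n R $$ (i, j) = 0\<^sub>m n n $$ (i, j)"
    using ij m n by (auto simp: centred_matrix_entry)
qed (use carrier_matD[OF centred_matrix_carrier[of m n R]] in simp_all)

text \<open>
  Dropping the blocker term and using \<open>d \<le> n - 1\<close> bounds each of the two summands of the numerator
  by \<open>n m\<^sup>2 (n - 1)\<close>, hence the constant \<open>2\<close>. For \<open>m = 0\<close> and \<open>m = n\<close> the trace vanishes with the matrix.
\<close>

lemma average_trace_stat_le:
  assumes "1 \<le> n" "m \<le> n"
  shows "average m n (trace_stat m n) \<le> 2 * real n * (real m)\<^sup>2"
proof (cases "m = 0 \<or> m = n")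
  case True
  have "trace_stat m n R = 0" if "R \<in> latin_rectangles m n" for R
  proof -
    have "centred_matrix m n R $$ (i, k) = 0" if "i < n" "k < n" for i k
      using centred_matrix_extreme[OF \<open>R \<in> _\<close> assms(1) True] that by simp
    then show ?thesis
      unfolding trace_stat_def mat_trace_gram_square[OF centred_matrix_carrier] by simp
  qed
  then have "average m n (trace_stat m n) = average m n (\<lambda>R. 0)"
    by (rule average_cong[OF assms(2)])
  then show ?thesis by (simp add: average_linear(4)[OF assms(2)])
next
  case False
  then have m: "1 \<le> m" "m < n" using assms by auto
  define d where "d = real n - real m"
  have d: "0 \<le> d" "d \<le> real n - 1" "d \<le> real n" using m by (auto simp: d_def)
  have B: "average m n (\<lambda>R. real (blocker_count m n 1 2 R)) \<ge> 0"
    unfolding average_def by (rule integral_nonneg_AE) simp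
  have "average m n (trace_stat m n) \<le> (real n * real m * (real m - 1) * d + (real m)\<^sup>2 * d\<^sup>2) / (real n - 1)"
    using average_trace_stat[OF m, of 1 2] m B by (simp add: d_def)
  also have "\<dots> \<le> (2 * real n * (real m)\<^sup>2 * (real n - 1)) / (real n - 1)"
  proof (rule divide_right_mono)
    have "real n * real m * (real m - 1) * d \<le> real n * real m * real m * (real n - 1)"
      using m d by (intro mult_mono) auto
    moreover have "(real m)\<^sup>2 * (d * d) \<le> (real m)\<^sup>2 * (real n * (real n - 1))"
      using d by (intro mult_left_mono mult_mono) auto
    ultimately show "real n * real m * (real m - 1) * d + (real m)\<^sup>2 * d\<^sup>2 \<le> 2 * real n * (real m)\<^sup>2 * (real n - 1)"
      by (simp add: power2_eq_square algebra_simps)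
  qed (use m in simp)
  also have "\<dots> = 2 * real n * (real m)\<^sup>2" using m by simp
  finally show ?thesis .
qed

theorem corollary5p2:
  shows
    "(\<forall>m n a b :: nat. 1 \<le> m \<and> m < n \<and> a \<in> {1..n} \<and> b \<in> {1..n} \<and> a \<noteq> b \<longrightarrow>
        (let d = real n - real m;
             E = measure_pmf.expectation (random_latin_rectangle m n)
         in E (trace_stat m n) =
              (real n * real m * (real m - 1) * d + (real m)\<^sup>2 * d\<^sup>2) / (real n - 1)
                - real n * E (\<lambda>R. real (blocker_count m n a b R)) \<and>
            E (trace_stat m n) \<le>
              (real n * real m * (real m - 1) * d + (real m)\<^sup>2 * d\<^sup>2) / (real n - 1))) \<and>
     (\<forall>m n :: nat. \<forall>R \<in> latin_rectangles m n.
        1 \<le> n \<and> (m = 0 \<or> m = n) \<longrightarrow> centred_matrix m n R = 0\<^sub>m n n) \<and>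
     (\<exists>c :: real. \<forall>n m :: nat. 1 \<le> n \<and> m \<le> n \<longrightarrow>
        measure_pmf.expectation (random_latin_rectangle m n) (trace_stat m n)
          \<le> c * real n * (real m)\<^sup>2)"
proof (intro conjI)
  show "\<forall>m n a b :: nat. 1 \<le> m \<and> m < n \<and> a \<in> {1..n} \<and> b \<in> {1..n} \<and> a \<noteq> b \<longrightarrow>
        (let d = real n - real m;
             E = measure_pmf.expectation (random_latin_rectangle m n)
         in E (trace_stat m n) =
              (real n * real m * (real m - 1) * d + (real m)\<^sup>2 * d\<^sup>2) / (real n - 1)
                - real n * E (\<lambda>R. real (blocker_count m n a b R)) \<and>
            E (trace_stat m n) \<le>
              (real n * real m * (real m - 1) * d + (real m)\<^sup>2 * d\<^sup>2) / (real n - 1))"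
  proof (intro allI impI)
    fix m n a b :: nat
    assume A: "1 \<le> m \<and> m < n \<and> a \<in> {1..n} \<and> b \<in> {1..n} \<and> a \<noteq> b"
    have "0 \<le> real n * average m n (\<lambda>R. real (blocker_count m n a b R))"
      unfolding average_def by (intro mult_nonneg_nonneg integral_nonneg_AE) simp_all
    with average_trace_stat[of m n a b] A
    show "let d = real n - real m;
             E = measure_pmf.expectation (random_latin_rectangle m n)
         in E (trace_stat m n) =
              (real n * real m * (real m - 1) * d + (real m)\<^sup>2 * d\<^sup>2) / (real n - 1)
                - real n * E (\<lambda>R. real (blocker_count m n a b R)) \<and>
            E (trace_stat m n) \<le>
              (real n * real m * (real m - 1) * d + (real m)\<^sup>2 * d\<^sup>2) / (real n - 1)"
      unfolding Let_def average_def by linarith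
  qed
  show "\<forall>m n :: nat. \<forall>R \<in> latin_rectangles m n.
        1 \<le> n \<and> (m = 0 \<or> m = n) \<longrightarrow> centred_matrix m n R = 0\<^sub>m n n"
    using centred_matrix_extreme by blast
  show "\<exists>c :: real. \<forall>n m :: nat. 1 \<le> n \<and> m \<le> n \<longrightarrow>
        measure_pmf.expectation (random_latin_rectangle m n) (trace_stat m n)
          \<le> c * real n * (real m)\<^sup>2"
    using average_trace_stat_le unfolding average_def by blast
qed

end
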